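(* Let $\mu$ be a Borel probability measure on $\mathbb{R}^d$ such that there is a bounded connected open Lipschitz domain $\Omega\subset B(0,1)$ with $\mu(dx)=\rho_\mu(x)\mathbf 1_\Omega(x)dx$ and constants $0<\underline\lambda_\mu\le\overline\lambda_\mu<\infty$ with $\underline\lambda_\mu\le\rho_\mu\le\overline\lambda_\mu$ a.e. on $\Omega$. Let $\nu$ be a probability measure such that the Monge map from $\mu$ to $\nu$ for the cost $c(x,y)=\frac12\|x-y\|^2$ is affine: $T(x)=Ax+a$ with $A$ symmetric positive definite and $a\in\mathbb{R}^d$. Let $\mu_A\coloneqq(A^{1/2})_\#\mu$ and $\Omega_A\coloneqq A^{1/2}\Omega$. Fix any $r_A>0$ and define $$\kappa_A\coloneqq\inf_{u\in\operatorname{spt}\mu_A}\ \inf_{0<r\le r_A}\frac{\mathrm{Leb}(\Omega_A\cap B(u,r))}{\omega_dr^d},\qquad \underline\lambda_{\mu_A}\coloneqq\frac{\underline\lambda_\mu}{\sqrt{\det A}},$$ and $\varepsilon_0\coloneqq\underline\lambda_{\mu_A}\kappa_A\omega_dr_A^{d+2}$. Then for all $\varepsilon\in(0,\varepsilon_0]$, $$\sup_{(x,y)\in\operatorname{spt}\pi_\varepsilon}\|y-T(x)\|\le 8\sqrt{\lambda_{\max}(A)}\left(\frac{\varepsilon}{\underline\lambda_{\mu_A}\kappa_A\omega_d}\right)^{\frac{1}{d+2}}=8\sqrt{\lambda_{\max}(A)}\left(\frac{\sqrt{\det A}\,\Gamma(\frac d2+1)}{\underline\lambda_\mu\kappa_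A\pi^{d/2}}\right)^{\frac1{d+2}}\varepsilon^{\frac1{d+2}}.$$
   Context: $P=\mu\otimes\nu$; for $\varepsilon>0$, $\pi_\varepsilon$ is the unique minimizer of $\int c\,d\pi+\frac\varepsilon2\|\frac{d\pi}{dP}\|^2_{L^2(P)}$ over couplings $\pi\in\Pi(\mu,\nu)$ with $\pi\ll P$. $B(u,r)$ is the closed Euclidean ball, $\omega_d=\pi^{d/2}/\Gamma(\frac d2+1)$ its unit volume, $\lambda_{\max}(A)$ the largest eigenvalue of $A$, $\operatorname{spt}$ the support, and $F_\#\mu$ the pushforward. *)

theory Defs
  imports "HOL-Analysis.Analysis" "HOL-Probability.Probability"
begin

definition msupport :: "'a::topological_space measure \<Rightarrow> 'a set" where
  "msupport M = {x. \<forall>U. open U \<and> x \<in> U \<longrightarrow> emeasure M U > 0}"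

text \<open>Lipschitz domain: open, bounded, and near every boundary point the set is,
  in a suitably rotated cylinder, the region below the graph of a Lipschitz function
  defined on the hyperplane orthogonal to a unit vector e.\<close>
definition lipschitz_domain :: "'a::euclidean_space set \<Rightarrow> bool" where
  "lipschitz_domain \<Omega> \<longleftrightarrow> open \<Omega> \<and> bounded \<Omega> \<and>
    (\<forall>p\<in>frontier \<Omega>. \<exists>(e::'a) r h L (g::'a \<Rightarrow> real).
        norm e = 1 \<and> r > 0 \<and> h > 0 \<and> lipschitz_on L {y. y \<bullet> e = 0} g \<and>
        (let C = {x. norm ((x - p) - ((x - p) \<bullet> e) *\<^sub>R e) < r \<and> \<bar>(x - p) \<bullet> e\<bar> < h}
         in \<Omega> \<inter> C = {x\<in>C. (x - p) \<bullet> e < g ((x - p) - ((x - p) \<bullet> e) *\<^sub>R e)}))"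

definition sym_matrix :: "real^'n^'n \<Rightarrow> bool" where
  "sym_matrix A \<longleftrightarrow> transpose A = A"

definition pos_def_matrix :: "real^'n^'n \<Rightarrow> bool" where
  "pos_def_matrix A \<longleftrightarrow> sym_matrix A \<and> (\<forall>x. x \<noteq> 0 \<longrightarrow> x \<bullet> (A *v x) > 0)"

definition pos_semidef_matrix :: "real^'n^'n \<Rightarrow> bool" where
  "pos_semidef_matrix A \<longleftrightarrow> sym_matrix A \<and> (\<forall>x. x \<bullet> (A *v x) \<ge> 0)"

definition matrix_sqrt :: "real^'n^'n \<Rightarrow> real^'n^'n" where
  "matrix_sqrt A = (THE S. pos_semidef_matrix S \<and> S ** S = A)"

definition lambda_max :: "real^'n^'n \<Rightarrow> real" where
  "lambda_max A = Max {l. \<exists>v. v \<noteq> 0 \<and> A *v v = l *\<^sub>R v}"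

text \<open>Volume of the unit ball in R^d.\<close>
definition omega :: "nat \<Rightarrow> real" where
  "omega d = pi powr (real d / 2) / Gamma (real d / 2 + 1)"

definition qcost :: "'a::real_normed_vector \<Rightarrow> 'a \<Rightarrow> real" where
  "qcost x y = (1/2) * (norm (x - y))\<^sup>2"

definition monge_map :: "'a::euclidean_space measure \<Rightarrow> 'a measure \<Rightarrow> ('a \<Rightarrow> 'a) \<Rightarrow> bool" where
  "monge_map \<mu> \<nu> T \<longleftrightarrow> T \<in> borel_measurable \<mu> \<and> distr \<mu> borel T = \<nu> \<and>
     (\<forall>S \<in> borel_measurable \<mu>. distr \<mu> borel S = \<nu> \<longrightarrow>
        (\<integral>\<^sup>+x. ennreal (qcost x (T x)) \<partial>\<mu>) \<le> (\<integral>\<^sup>+x. ennreal (qcost x (S x)) \<partial>\<mu>))"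

definition coupling :: "'a::euclidean_space measure \<Rightarrow> 'a measure \<Rightarrow> ('a \<times> 'a) measure \<Rightarrow> bool" where
  "coupling \<mu> \<nu> \<pi> \<longleftrightarrow> sets \<pi> = sets (borel \<Otimes>\<^sub>M borel) \<and>
     distr \<pi> borel fst = \<mu> \<and> distr \<pi> borel snd = \<nu>"

text \<open>Quadratically regularised OT objective (value +infinity when the density is not in L^2(P)).\<close>
definition qrot_objective :: "'a::euclidean_space measure \<Rightarrow> 'a measure \<Rightarrow> real \<Rightarrow> ('a \<times> 'a) measure \<Rightarrow> ennreal" where
  "qrot_objective \<mu> \<nu> \<epsilon> \<pi> =
     (\<integral>\<^sup>+z. ennreal (qcost (fst z) (snd z)) \<partial>\<pi>) +
     ennreal (\<epsilon> / 2) * (\<integral>\<^sup>+z. (RN_deriv (\<mu> \<Otimes>\<^sub>M \<nu>) \<pi> z)\<^sup>2 \<partial>(\<mu> \<Otimes>\<^sub>M \<nu>))"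

definition admissible_coupling :: "'a::euclidean_space measure \<Rightarrow> 'a measure \<Rightarrow> ('a \<times> 'a) measure \<Rightarrow> bool" where
  "admissible_coupling \<mu> \<nu> \<pi> \<longleftrightarrow> coupling \<mu> \<nu> \<pi> \<and> absolutely_continuous (\<mu> \<Otimes>\<^sub>M \<nu>) \<pi>"

definition qrot_minimizer :: "'a::euclidean_space measure \<Rightarrow> 'a measure \<Rightarrow> real \<Rightarrow> ('a \<times> 'a) measure \<Rightarrow> bool" where
  "qrot_minimizer \<mu> \<nu> \<epsilon> \<pi> \<longleftrightarrow> admissible_coupling \<mu> \<nu> \<pi> \<and>
     (\<forall>\<pi>'. admissible_coupling \<mu> \<nu> \<pi>' \<longrightarrow> qrot_objective \<mu> \<nu> \<epsilon> \<pi> \<le> qrot_objective \<mu> \<nu> \<epsilon> \<pi>')"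

end

theory Submission
  imports Defs
begin

text \<open>
  Writing \<open>S = A\<^sup>1\<^sup>/\<^sup>2\<close> and substituting \<open>y = T x'\<close>, the minimizer becomes a density \<open>h\<close> of a
  self-coupling of \<open>\<mu>\<close> that is optimal, up to functions of one variable, for the cost
  \<open>\<bar>S x - S x'\<bar>\<^sup>2 / 2\<close>. The first variation says that \<open>h\<close> minimizes the linear functional with cost
  \<open>G = \<bar>S x - S x'\<bar>\<^sup>2 / 2 + \<epsilon> h\<close>, so moving mass along finite cycles of points of the support cannot
  decrease the total of \<open>G\<close>; moreover \<open>h\<close> is symmetric.

  Let \<open>R\<close> bound \<open>\<bar>S x - S x'\<bar>\<close> on the support and choose \<open>\<delta>\<close> such that \<open>\<delta>\<close>-balls have mass at least
  \<open>\<epsilon> / \<delta>\<^sup>2\<close>. For a support point \<open>(x, y)\<close>, the pairs \<open>(x, y), (y, x), (a, b), (a', b')\<close> are replaced by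
  \<open>(x, b), (a, x), (y, b'), (a', y)\<close>, where \<open>b\<close> is \<open>\<delta>\<close>-close to \<open>x\<close> with \<open>\<epsilon> h (x, b) \<le> \<delta>\<^sup>2\<close>, where
  \<open>h (a, x) \<le> h (a, b)\<close>, and similarly for \<open>a', b', y\<close>. This gives
  \<open>\<bar>S x - S y\<bar>\<^sup>2 \<le> 4 \<delta>\<^sup>2 + 2 \<delta> R\<close>, and iterating the bound brings \<open>R\<close> down to \<open>8 \<delta>\<close>.
\<close>

text \<open>Two obstacles shape the argument. No bound on \<open>h\<close> is available, so the
  regularizing term is compared rather than estimated: \<epsilon> h (a, x) is only set against
  \<epsilon> h (a, b), and \<epsilon> h (x, b) is controlled because a row of mass one cannot exceed
  \<delta>^2 / \<epsilon> throughout a set of mass \<epsilon> / \<delta>^2. Moreover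
  \<open>h\<close> is determined only almost everywhere, so no single cycle of points can be tested;
  cycles are drawn at random and the exchange is one of measures. The reflected pair (y, x) closes
  the cycle cheaply: (x, y) alone would free only y as a second coordinate, yet x too has to become
  a partner. Inserting x beside b costs at most 2 \<delta>^2 + \<delta> R, since replacing b by x
  changes the distance to a by at most \<delta>, while the removed pairs (x, y) and (y, x) together
  save |S x - S y|^2. The fixed point of R^2 = 4 \<delta>^2 + 2 \<delta> R is (1 + sqrt 5) \<delta>;
  the larger value 8 \<delta> leaves room for a contraction by 3/4 that ends after finitely many
  steps.\<close>

section \<open>Symmetric matrices and their square roots\<close>

text \<open>A maximizer \<open>x\<close> of the quadratic form on the unit sphere of
  \<open>V\<close> is an eigenvector: invariance puts the residual \<open>w\<close> in
  \<open>V\<close>, so moving from \<open>x\<close> along \<open>w\<close> is allowed, and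
  first-order optimality forces \<open>w = 0\<close>.\<close>

lemma selfadjoint_invariant_eigenvector:
  fixes f :: "'a::euclidean_space \<Rightarrow> 'a"
  assumes f: "linear f" and sa: "\<And>x y. f x \<bullet> y = x \<bullet> f y"
    and V: "subspace V" "f ` V \<subseteq> V" "V \<noteq> {0}"
  obtains x where "x \<in> V" "norm x = 1" "f x = (x \<bullet> f x) *\<^sub>R x"
proof -
  let ?K = "V \<inter> sphere 0 1"
  obtain v where v: "v \<in> V" "v \<noteq> 0"
    using V subspace_0 by blast
  then have "v /\<^sub>R norm v \<in> ?K"
    using V(1) by (simp add: subspace_scale)
  moreover have "compact ?K"
    using V(1) by (simp add: closed_Int_compact closed_subspace)
  moreover have "continuous_on ?K (\<lambda>x. x \<bullet> f x)"
    by (intro continuous_intros linear_continuous_on linear_conv_bounded_linear[THEN iffD1] f)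
  ultimately obtain x where x: "x \<in> ?K" and max: "\<And>y. y \<in> ?K \<Longrightarrow> y \<bullet> f y \<le> x \<bullet> f x"
    using continuous_attains_sup[of ?K "\<lambda>x. x \<bullet> f x"] by blast
  define l where "l = x \<bullet> f x"
  have xx: "x \<bullet> x = 1"
    using x by (simp add: dot_square_norm)
  have rayleigh: "y \<bullet> f y \<le> l * (y \<bullet> y)" if "y \<in> V" for y
  proof (cases "y = 0")
    case True
    then show ?thesis by simp
  next
    case False
    have "(y /\<^sub>R norm y) \<bullet> f (y /\<^sub>R norm y) \<le> l"
      unfolding l_def using that False V(1) by (intro max) (simp add: subspace_scale)
    then show ?thesis
      using False by (simp add: linear_cmul[OF f] field_simps dot_square_norm power2_eq_square)
  qed
  define w where "w = f x - l *\<^sub>R x"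
  have wV: "w \<in> V"
    unfolding w_def using x V by (intro subspace_diff subspace_scale) auto
  have xw: "x \<bullet> w = 0"
    by (simp add: w_def inner_diff_right xx l_def)
  have fxw: "w \<bullet> f x = w \<bullet> w"
    using xw by (simp add: w_def inner_diff_right inner_diff_left inner_commute)
  have key: "2 * t * (w \<bullet> w) \<le> t\<^sup>2 * (l * (w \<bullet> w) - w \<bullet> f w)" for t
  proof -
    have "(x + t *\<^sub>R w) \<bullet> f (x + t *\<^sub>R w) \<le> l * ((x + t *\<^sub>R w) \<bullet> (x + t *\<^sub>R w))"
      using x wV V(1) by (intro rayleigh subspace_add subspace_scale) auto
    moreover have "x \<bullet> f w = w \<bullet> f x"
      using sa[of x w] by (simp add: inner_commute)
    ultimately show ?thesis
      using xw xx fxw by (simp add: linear_add[OF f] linear_cmul[OF f] inner_simps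
          inner_commute[of w x] l_def[symmetric] power2_eq_square algebra_simps)
  qed
  have "w \<bullet> w = 0"
  proof (rule ccontr)
    assume "w \<bullet> w \<noteq> 0"
    then have pos: "w \<bullet> w > 0" by (simp add: order_less_le)
    \<comment> \<open>\<open>c\<close> is positive and strictly dominates the quadratic coefficient
      in \<open>key\<close>; the choice of \<open>t\<close> makes \<open>t * c\<close> equal to
      \<open>w \<bullet> w\<close>, so \<open>key\<close> would bound twice this quantity by
      itself.\<close>
    define c where "c = \<bar>l * (w \<bullet> w) - w \<bullet> f w\<bar> + 1"
    define t where "t = (w \<bullet> w) / c"
    have c: "c > 0" "l * (w \<bullet> w) - w \<bullet> f w < c" by (auto simp: c_def)
    have t: "t > 0" using pos c by (simp add: t_def)
    have "2 * t * (w \<bullet> w) \<le> t\<^sup>2 * c"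
      using key[of t] mult_left_mono[of "l * (w \<bullet> w) - w \<bullet> f w" c "t\<^sup>2"] c by simp
    then have "2 * (w \<bullet> w) \<le> t * c"
      using t by (simp add: power2_eq_square)
    then show False
      using pos c by (simp add: t_def)
  qed
  then have "f x = l *\<^sub>R x"
    by (simp add: w_def)
  then show thesis
    using that[of x] x by (simp add: l_def)
qed

text \<open>Induction on the dimension: self-adjointness makes the orthogonal complement of an
  eigenvector inside \<open>V\<close> invariant again.\<close>

lemma selfadjoint_orthonormal_eigenbasis_on:
  fixes f :: "'a::euclidean_space \<Rightarrow> 'a"
  assumes f: "linear f" and sa: "\<And>x y. f x \<bullet> y = x \<bullet> f y"
  shows "subspace V \<Longrightarrow> f ` V \<subseteq> V \<Longrightarrow>
    \<exists>B l. finite B \<and> pairwise orthogonal B \<and> (\<forall>b\<in>B. norm b = 1 \<and> f b = l b *\<^sub>R b) \<and> span B = V"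
proof (induction "dim V" arbitrary: V rule: less_induct)
  case less
  show ?case
  proof (cases "V = {0}")
    case True
    then show ?thesis
      by (intro exI[of _ "{}"]) (auto simp: pairwise_def)
  next
    case False
    obtain x where x: "x \<in> V" "norm x = 1" "f x = (x \<bullet> f x) *\<^sub>R x"
      using selfadjoint_invariant_eigenvector[OF f sa less.prems False] by blast
    define W where "W = V \<inter> {y. x \<bullet> y = 0}"
    have W: "subspace W"
      using less.prems(1) subspace_hyperplane unfolding W_def by (rule subspace_inter)
    have "x \<notin> W"
      using x(2) by (auto simp: W_def dot_square_norm)
    moreover have "W \<subseteq> V"
      by (auto simp: W_def)
    ultimately have "W \<subset> V"
      using x(1) by blast
    then have dim: "dim W < dim V"
      using W less.prems(1) by (metis dim_psubset span_eq_iff)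
    have "f ` W \<subseteq> W"
    proof safe
      fix y assume y: "y \<in> W"
      have "x \<bullet> f y = (x \<bullet> f x) * (x \<bullet> y)"
        using sa[of x y] x(3) by (metis inner_scaleR_left)
      then show "f y \<in> W"
        using y less.prems(2) by (auto simp: W_def)
    qed
    from less.hyps[OF dim W this] obtain B l where
      B: "finite B" "pairwise orthogonal B" "\<forall>b\<in>B. norm b = 1 \<and> f b = l b *\<^sub>R b" "span B = W"
      by blast
    have BW: "b \<in> W" if "b \<in> B" for b
      using that B(4) span_base by blast
    show ?thesis
    proof (intro exI conjI)
      show "finite (insert x B)" using B by simp
      show "pairwise orthogonal (insert x B)"
        using B(2) BW by (auto simp: pairwise_insert orthogonal_def W_def inner_commute)
      \<comment> \<open>Rayleigh quotients serve as eigenvalues for old and new vectors alike, so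
        the function \<open>l\<close> of the induction hypothesis need not be extended to
        \<open>x\<close>.\<close>
      show "\<forall>b\<in>insert x B. norm b = 1 \<and> f b = (b \<bullet> f b) *\<^sub>R b"
        using x B(3) by (auto simp: dot_square_norm)
      show "span (insert x B) = V"
      proof
        show "span (insert x B) \<subseteq> V"
          using x(1) BW less.prems(1) by (intro span_minimal) (auto simp: W_def)
        show "V \<subseteq> span (insert x B)"
        proof
          fix v assume v: "v \<in> V"
          have "v - (x \<bullet> v) *\<^sub>R x \<in> W"
            using v x less.prems(1)
            by (auto simp: W_def inner_diff_right dot_square_norm intro!: subspace_diff subspace_scale)
          then show "v \<in> span (insert x B)"
            unfolding span_insert B(4) by blast
        qed
      qed
    qed
  qed
qed

lemma selfadjoint_orthonormal_eigenbasis: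
  fixes f :: "'a::euclidean_space \<Rightarrow> 'a"
  assumes "linear f" "\<And>x y. f x \<bullet> y = x \<bullet> f y"
  obtains B l where "finite B" "\<And>b c. b \<in> B \<Longrightarrow> c \<in> B \<Longrightarrow> b \<bullet> c = (if b = c then 1 else 0)"
    "\<And>b. b \<in> B \<Longrightarrow> f b = l b *\<^sub>R b" "\<And>x. x = (\<Sum>b\<in>B. (x \<bullet> b) *\<^sub>R b)"
proof -
  obtain B l where B: "finite B" "pairwise orthogonal B"
    "\<forall>b\<in>B. norm b = 1 \<and> f b = l b *\<^sub>R b" "span B = UNIV"
    using selfadjoint_orthonormal_eigenbasis_on[OF assms subspace_UNIV] by blast
  have on: "b \<bullet> c = (if b = c then 1 else 0)" if "b \<in> B" "c \<in> B" for b c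
    using that B(2,3) by (auto simp: pairwise_def orthogonal_def dot_square_norm)
  have "x = (\<Sum>b\<in>B. (x \<bullet> b) *\<^sub>R b)" for x
  proof -
    obtain u where u: "x = (\<Sum>b\<in>B. u b *\<^sub>R b)"
      using B(1,4) span_finite[of B] by auto
    have "x \<bullet> b = u b" if "b \<in> B" for b
    proof -
      have "x \<bullet> b = (\<Sum>c\<in>B. if b = c then u c else 0)"
        unfolding u inner_sum_left using on[OF that] by (intro sum.cong) (auto simp: inner_commute)
      then show ?thesis
        using that B(1) by simp
    qed
    then show ?thesis
      by (subst u) (rule sum.cong, auto)
  qed
  then show thesis
    using that B(1,3) on by blast
qed

lemma sym_matrix_selfadjoint: "sym_matrix M \<Longrightarrow> (M *v x) \<bullet> y = x \<bullet> (M *v y)"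
  unfolding sym_matrix_def by (metis dot_lmul_matrix vector_transpose_matrix)

lemma sym_matrix_eigenbasis:
  fixes M :: "real^'n^'n"
  assumes "sym_matrix M"
  obtains B l where "finite B" "\<And>b c. b \<in> B \<Longrightarrow> c \<in> B \<Longrightarrow> b \<bullet> c = (if b = c then 1 else 0)"
    "\<And>b. b \<in> B \<Longrightarrow> M *v b = l b *\<^sub>R b" "\<And>x. x = (\<Sum>b\<in>B. (x \<bullet> b) *\<^sub>R b)"
  by (rule selfadjoint_orthonormal_eigenbasis[OF matrix_vector_mul_linear sym_matrix_selfadjoint[OF assms]])
    (rule that)

text \<open>The core of the uniqueness of the root. In an eigenbasis of \<open>S\<close> each
  coordinate gives \<open>s b * s b = l\<close> or \<open>w \<bullet> b = 0\<close>; nonnegativity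
  of \<open>s b\<close> excludes the negative root, so every nonzero coordinate is scaled by
  \<open>sqrt l\<close>.\<close>

lemma pos_semidef_sqrt_eigenvector:
  fixes S :: "real^'n^'n"
  assumes S: "pos_semidef_matrix S" and w: "(S ** S) *v w = l *\<^sub>R w"
  shows "S *v w = sqrt l *\<^sub>R w"
proof -
  have sym: "sym_matrix S"
    using S by (simp add: pos_semidef_matrix_def)
  obtain B s where B: "finite B" "\<And>b c. b \<in> B \<Longrightarrow> c \<in> B \<Longrightarrow> b \<bullet> c = (if b = c then 1 else 0)"
    "\<And>b. b \<in> B \<Longrightarrow> S *v b = s b *\<^sub>R b" "\<And>x. x = (\<Sum>b\<in>B. (x \<bullet> b) *\<^sub>R b)"
    by (rule sym_matrix_eigenbasis[OF sym]) blast
  have coord: "(S *v w) \<bullet> b = sqrt l * (w \<bullet> b)" if "b \<in> B" for b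
  proof -
    have 1: "(S *v x) \<bullet> b = s b * (x \<bullet> b)" for x
      using that by (simp add: sym_matrix_selfadjoint[OF sym] B(3))
    have "s b * (s b * (w \<bullet> b)) = ((S ** S) *v w) \<bullet> b"
      by (simp only: matrix_vector_mul_assoc[symmetric] 1)
    then have "s b * (s b * (w \<bullet> b)) = l * (w \<bullet> b)"
      unfolding w by simp
    then have "s b * s b = l \<or> w \<bullet> b = 0"
      by (metis mult.assoc mult_cancel_right)
    moreover have "s b \<ge> 0"
      using S that B(2)[of b b] by (auto simp: pos_semidef_matrix_def B(3) dest!: spec[of _ b])
    ultimately have "sqrt l = s b \<or> w \<bullet> b = 0"
      by auto
    then show ?thesis
      using 1[of w] by auto
  qed
  have "S *v w = (\<Sum>b\<in>B. ((S *v w) \<bullet> b) *\<^sub>R b)"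
    by (rule B(4))
  also have "\<dots> = sqrt l *\<^sub>R (\<Sum>b\<in>B. (w \<bullet> b) *\<^sub>R b)"
    by (simp add: scaleR_right.sum coord)
  finally show ?thesis
    using B(4)[of w] by simp
qed

text \<open>\<open>matrix_sqrt\<close> is a definite description, so existence and uniqueness both
  have to be settled first. The root takes \<open>sqrt\<close> of the eigenvalues in an eigenbasis
  of \<open>M\<close>; any other root acts in the same way on that basis.\<close>

lemma matrix_sqrt_props:
  fixes M :: "real^'n^'n"
  assumes "pos_semidef_matrix M"
  shows "pos_semidef_matrix (matrix_sqrt M)" "matrix_sqrt M ** matrix_sqrt M = M"
proof -
  have sym: "sym_matrix M"
    using assms by (simp add: pos_semidef_matrix_def)
  obtain B l where B: "finite B" "\<And>b c. b \<in> B \<Longrightarrow> c \<in> B \<Longrightarrow> b \<bullet> c = (if b = c then 1 else 0)"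
    "\<And>b. b \<in> B \<Longrightarrow> M *v b = l b *\<^sub>R b" "\<And>x. x = (\<Sum>b\<in>B. (x \<bullet> b) *\<^sub>R b)"
    by (rule sym_matrix_eigenbasis[OF sym]) blast
  have l: "l b \<ge> 0" if "b \<in> B" for b
    using assms that B(2)[of b b] by (auto simp: pos_semidef_matrix_def B(3) dest!: spec[of _ b])
  have ext: "F = G" if "\<And>b. b \<in> B \<Longrightarrow> F *v b = G *v b" for F G :: "real^'n^'n"
  proof -
    have "F *v x = G *v x" for x
    proof -
      have lin: "H *v x = (\<Sum>b\<in>B. (x \<bullet> b) *\<^sub>R (H *v b))" for H :: "real^'n^'n"
        by (subst B(4)[of x]) (simp add: linear_sum[OF matrix_vector_mul_linear] matrix_vector_mult_scaleR)
      show ?thesis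
        unfolding lin using that by (simp cong: sum.cong)
    qed
    then show ?thesis
      by (simp add: matrix_eq)
  qed
  define g where "g x = (\<Sum>b\<in>B. (sqrt (l b) * (x \<bullet> b)) *\<^sub>R b)" for x
  have g: "linear g"
    by (rule linearI) (auto simp: g_def inner_simps algebra_simps sum.distrib scaleR_right.sum)
  define S where "S = matrix g"
  have S: "S *v x = g x" for x
    unfolding S_def by (simp add: g matrix_works)
  have Sb: "S *v b = sqrt (l b) *\<^sub>R b" if "b \<in> B" for b
  proof -
    have "g b = (\<Sum>c\<in>B. if b = c then sqrt (l c) *\<^sub>R c else 0)"
      unfolding g_def using that B(2)[OF that] by (intro sum.cong) auto
    then show ?thesis
      using that B(1) by (simp add: S)
  qed
  have "g x \<bullet> y = x \<bullet> g y" for x y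
    unfolding g_def inner_sum_left inner_sum_right
    by (rule sum.cong) (auto simp: inner_commute[of _ y])
  then have "adjoint g = g"
    by (intro adjoint_unique) auto
  then have "transpose S = S"
    using matrix_adjoint[OF g] by (simp add: S_def)
  moreover have "x \<bullet> (S *v x) \<ge> 0" for x
  proof -
    have "x \<bullet> (S *v x) = (\<Sum>b\<in>B. sqrt (l b) * (x \<bullet> b)\<^sup>2)"
      by (simp add: S g_def inner_sum_right power2_eq_square mult_ac)
    then show ?thesis
      using l by (simp add: sum_nonneg)
  qed
  ultimately have psd: "pos_semidef_matrix S"
    by (simp add: pos_semidef_matrix_def sym_matrix_def)
  have sq: "S ** S = M"
    using l by (intro ext) (simp add: matrix_vector_mul_assoc[symmetric] Sb matrix_vector_mult_scaleR B(3))
  have "\<exists>!S. pos_semidef_matrix S \<and> S ** S = M"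
  proof (rule ex1I[of _ S])
    fix R assume R: "pos_semidef_matrix R \<and> R ** R = M"
    show "R = S"
      using R pos_semidef_sqrt_eigenvector[of R] by (intro ext) (simp add: B(3) Sb)
  qed (use psd sq in simp)
  then have "pos_semidef_matrix (matrix_sqrt M) \<and> matrix_sqrt M ** matrix_sqrt M = M"
    unfolding matrix_sqrt_def by (rule theI')
  then show "pos_semidef_matrix (matrix_sqrt M)" "matrix_sqrt M ** matrix_sqrt M = M"
    by auto
qed

lemma rayleigh_le_lambda_max:
  fixes M :: "real^'n^'n"
  assumes sym: "sym_matrix M"
  shows "x \<bullet> (M *v x) \<le> lambda_max M * (norm x)\<^sup>2"
proof -
  obtain B l where B: "finite B" "\<And>b c. b \<in> B \<Longrightarrow> c \<in> B \<Longrightarrow> b \<bullet> c = (if b = c then 1 else 0)"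
    "\<And>b. b \<in> B \<Longrightarrow> M *v b = l b *\<^sub>R b" "\<And>x. x = (\<Sum>b\<in>B. (x \<bullet> b) *\<^sub>R b)"
    by (rule sym_matrix_eigenbasis[OF sym]) blast
  let ?E = "{l. \<exists>v. v \<noteq> 0 \<and> M *v v = l *\<^sub>R v}"
  \<comment> \<open>\<open>Max\<close> is informative only for a finite set. An eigenvector has a
    nonzero coordinate on some basis vector \<open>b\<close>, and this pins its eigenvalue to
    \<open>l b\<close>.\<close>
  have "?E \<subseteq> l ` B"
  proof safe
    fix k v assume v: "v \<noteq> 0" "M *v v = k *\<^sub>R v"
    obtain b where b: "b \<in> B" "v \<bullet> b \<noteq> 0"
      using B(4)[of v] v(1) by (metis (no_types, lifting) scale_zero_left sum.neutral)
    have "k * (v \<bullet> b) = l b * (v \<bullet> b)"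
      using sym_matrix_selfadjoint[OF sym, of v b] v(2) B(3)[OF b(1)] by simp
    then show "k \<in> l ` B"
      using b by auto
  qed
  then have fin: "finite ?E"
    using B(1) finite_surj by blast
  have le: "l b \<le> lambda_max M" if "b \<in> B" for b
    unfolding lambda_max_def
  proof (rule Max_ge[OF fin])
    have "b \<noteq> 0"
      using B(2)[OF that that] by auto
    then show "l b \<in> ?E"
      using B(3)[OF that] by blast
  qed
  have inner: "x \<bullet> y = (\<Sum>b\<in>B. (x \<bullet> b) * (y \<bullet> b))" for y
    by (subst B(4)[of y]) (simp add: inner_sum_right mult.commute)
  have "x \<bullet> (M *v x) = (\<Sum>b\<in>B. l b * (x \<bullet> b)\<^sup>2)"
    by (subst inner) (rule sum.cong, auto simp: sym_matrix_selfadjoint[OF sym] B(3) power2_eq_square)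
  also have "\<dots> \<le> (\<Sum>b\<in>B. lambda_max M * (x \<bullet> b)\<^sup>2)"
    by (intro sum_mono mult_right_mono le) auto
  also have "\<dots> = lambda_max M * (norm x)\<^sup>2"
    by (simp add: sum_distrib_left[symmetric] power2_norm_eq_inner inner[of x] power2_eq_square[of "x \<bullet> _"])
  finally show ?thesis .
qed

section \<open>Linear images of Borel sets\<close>

text \<open>The change of variables formula for linear maps is available for well-ordered index types
  only; a copy of the index type supplies the order.\<close>
typedef 'n wo = "UNIV :: 'n set"
  by simp

lemma bij_Rep_wo: "bij (Rep_wo :: 'n wo \<Rightarrow> 'n)" and bij_Abs_wo: "bij (Abs_wo :: 'n \<Rightarrow> 'n wo)"
  by (rule bij_betw_byWitness[where f'=Abs_wo], simp_all add: Rep_wo_inverse Abs_wo_inverse)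
    (rule bij_betw_byWitness[where f'=Rep_wo], simp_all add: Rep_wo_inverse Abs_wo_inverse)

instance wo :: (finite) finite
proof
  show "finite (UNIV :: 'a wo set)"
    by (metis bij_Abs_wo bij_is_surj finite finite_imageI)
qed

definition wo_index :: "'n::finite wo \<Rightarrow> nat" where
  "wo_index x = to_nat_on UNIV (Rep_wo x)"

lemma wo_index_inject: "wo_index x = wo_index y \<longleftrightarrow> x = y"
proof -
  have "inj (to_nat_on (UNIV :: 'a set))"
    by (intro inj_on_to_nat_on) auto
  then show ?thesis
    by (auto simp: wo_index_def Rep_wo_inject dest: injD)
qed

instantiation wo :: (finite) wellorder
begin

definition less_eq_wo :: "'a wo \<Rightarrow> 'a wo \<Rightarrow> bool" where
  "less_eq_wo x y \<longleftrightarrow> wo_index x \<le> wo_index y"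

definition less_wo :: "'a wo \<Rightarrow> 'a wo \<Rightarrow> bool" where
  "less_wo x y \<longleftrightarrow> wo_index x < wo_index y"

instance
proof
  fix P :: "'a wo \<Rightarrow> bool" and a
  assume step: "\<And>x. (\<And>y. y < x \<Longrightarrow> P y) \<Longrightarrow> P x"
  show "P a"
  proof (induction "wo_index a" arbitrary: a rule: less_induct)
    case less
    show ?case
      by (rule step) (simp add: less less_wo_def)
  qed
qed (auto simp: less_eq_wo_def less_wo_def wo_index_inject intro: wo_index_inject[THEN iffD1])

end

lemma sum_Rep_wo: "(\<Sum>j\<in>UNIV. f (Rep_wo j)) = (\<Sum>i\<in>UNIV. f i)"
  by (rule sum.reindex_bij_betw[OF bij_Rep_wo])

lemma prod_Rep_wo: "(\<Prod>j\<in>UNIV. f (Rep_wo j)) = (\<Prod>i\<in>UNIV. f i)"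
  by (rule prod.reindex_bij_betw[OF bij_Rep_wo])

text \<open>Conjugation by the relabelling is a sign-preserving bijection between the permutations
  of the two index types, so the Leibniz sums agree term by term.\<close>

lemma det_Rep_wo:
  fixes M :: "'a::comm_ring_1^'n^'n"
  shows "det (\<chi> i j. M $ Rep_wo i $ Rep_wo j) = det M"
proof -
  let ?c = "\<lambda>p. Abs_wo \<circ> p \<circ> Rep_wo" and ?c' = "\<lambda>p. Rep_wo \<circ> p \<circ> Abs_wo"
  have inv: "inv_into UNIV Abs_wo = (Rep_wo :: 'n wo \<Rightarrow> 'n)"
    by (rule inv_equality) (simp_all add: Rep_wo_inverse Abs_wo_inverse)
  have c: "?c p permutes UNIV" "sign (?c p) = sign p" if "p permutes UNIV" for p :: "'n \<Rightarrow> 'n"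
  proof -
    have "bij p"
      using that by (simp add: permutes_bij)
    then show "?c p permutes UNIV"
      by (intro bij_imp_permutes bij_comp bij_Rep_wo bij_Abs_wo) auto
    have "map_permutation UNIV Abs_wo p = ?c p"
      by (simp add: map_permutation_def restrict_id_def inv fun_eq_iff bij_is_surj[OF bij_Abs_wo])
    then show "sign (?c p) = sign p"
      using sign_map_permutation[OF bij_is_inj[OF bij_Abs_wo] that] by simp
  qed
  have c': "?c' p permutes UNIV" if "p permutes UNIV" for p :: "'n wo \<Rightarrow> 'n wo"
    using permutes_bij[OF that] by (intro bij_imp_permutes bij_comp bij_Rep_wo bij_Abs_wo) auto
  have cc: "?c (?c' p) = p" for p :: "'n wo \<Rightarrow> 'n wo"
    by (simp add: fun_eq_iff Rep_wo_inverse Abs_wo_inverse)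
  have cc': "?c' (?c p) = p" for p :: "'n \<Rightarrow> 'n"
    by (simp add: fun_eq_iff Rep_wo_inverse Abs_wo_inverse)
  have "det (\<chi> i j. M $ Rep_wo i $ Rep_wo j) =
      (\<Sum>p\<in>{p. p permutes UNIV}. of_int (sign p) * (\<Prod>i\<in>UNIV. M $ Rep_wo i $ Rep_wo (p i)))"
    by (simp add: det_def)
  also have "\<dots> = (\<Sum>p\<in>{p. p permutes UNIV}. of_int (sign (?c p)) * (\<Prod>i\<in>UNIV. M $ Rep_wo i $ Rep_wo (?c p i)))"
    by (rule sum.reindex_bij_witness[of _ ?c ?c']) (use c c' cc cc' in auto)
  also have "\<dots> = (\<Sum>p\<in>{p. p permutes UNIV}. of_int (sign p) * (\<Prod>i\<in>UNIV. M $ i $ p i))"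
  proof (rule sum.cong)
    fix p :: "'n \<Rightarrow> 'n" assume "p \<in> {p. p permutes UNIV}"
    then show "of_int (sign (?c p)) * (\<Prod>i\<in>UNIV. M $ Rep_wo i $ Rep_wo (?c p i)) =
        of_int (sign p) * (\<Prod>i\<in>UNIV. M $ i $ p i)"
      using c(2) prod_Rep_wo[of "\<lambda>i. M $ i $ p i"] by (simp add: Abs_wo_inverse)
  qed simp
  finally show ?thesis
    by (simp add: det_def)
qed

lemma emeasure_lborel_box_cart:
  fixes l u :: "real^'n"
  assumes "\<And>i. l $ i \<le> u $ i"
  shows "emeasure lborel (box l u) = (\<Prod>i\<in>UNIV. ennreal (u $ i - l $ i))"
proof -
  have "emeasure lborel (box l u) = ennreal (\<Prod>b\<in>Basis. (u - l) \<bullet> b)"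
    using assms by (intro emeasure_lborel_box) (auto simp: Basis_vec_def inner_axis)
  also have "(Basis :: (real^'n) set) = range (\<lambda>i. axis i 1)"
    by (auto simp: Basis_vec_def)
  also have "(\<Prod>b\<in>range (\<lambda>i. axis i 1). (u - l) \<bullet> b) = (\<Prod>i\<in>UNIV. u $ i - l $ i)"
    by (subst prod.reindex) (auto simp: inj_on_def axis_eq_axis inner_axis)
  finally show ?thesis
    using assms by (simp add: prod_ennreal)
qed

text \<open>Relabelling coordinates preserves volume and conjugates \<open>M\<close> to a matrix of
  the same determinant, so the formula for the well-ordered copy transfers. The image is assumed
  Borel in order to pass from Lebesgue measure back to \<open>lborel\<close>.\<close>

lemma measure_linear_image_cart:
  fixes M :: "real^'n^'n"
  assumes W: "W \<in> sets borel" "bounded W" and MW: "(*v) M ` W \<in> sets borel"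
  shows "measure lborel ((*v) M ` W) = \<bar>det M\<bar> * measure lborel W"
proof -
  define R :: "real^'n \<Rightarrow> real^'n wo" where "R x = (\<chi> j. x $ Rep_wo j)" for x
  define R' :: "real^'n wo \<Rightarrow> real^'n" where "R' y = (\<chi> i. y $ Abs_wo i)" for y
  have RR': "R (R' y) = y" and R'R: "R' (R x) = x" for x y
    by (simp_all add: R_def R'_def vec_eq_iff Rep_wo_inverse Abs_wo_inverse)
  have linR: "linear R" and linR': "linear R'"
    by (auto intro!: linearI simp: R_def R'_def vec_eq_iff)
  have [measurable]: "R \<in> borel_measurable borel" "R' \<in> borel_measurable borel"
    using linR linR' by (auto intro!: borel_measurable_continuous_onI linear_continuous_on simp: linear_conv_bounded_linear)
  \<comment> \<open>\<open>lborel\<close> is determined by its values on boxes, and preimages of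
    boxes under \<open>R\<close> are boxes with the same side lengths in another order.\<close>
  have lb: "lborel = distr lborel borel R"
  proof (rule lborel_eqI)
    fix l u :: "real^'n wo" assume le: "\<And>b. b \<in> Basis \<Longrightarrow> l \<bullet> b \<le> u \<bullet> b"
    have lu: "l $ i \<le> u $ i" for i
      using le[of "axis i 1"] by (auto simp: Basis_vec_def inner_axis)
    have "R -` box l u = box (R' l) (R' u)"
    proof (rule set_eqI)
      fix x
      have "(\<forall>j. l $ j < x $ Rep_wo j \<and> x $ Rep_wo j < u $ j) \<longleftrightarrow>
          (\<forall>i. l $ Abs_wo i < x $ i \<and> x $ i < u $ Abs_wo i)"
        by (metis Abs_wo_inverse Rep_wo_inverse UNIV_I)
      then show "x \<in> R -` box l u \<longleftrightarrow> x \<in> box (R' l) (R' u)"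
        by (simp add: mem_box_cart R_def R'_def)
    qed
    then have "emeasure (distr lborel borel R) (box l u) = emeasure lborel (box (R' l) (R' u))"
      by (simp add: emeasure_distr)
    also have "\<dots> = (\<Prod>i\<in>UNIV. ennreal (u $ Abs_wo i - l $ Abs_wo i))"
      using lu by (subst emeasure_lborel_box_cart) (auto simp: R'_def)
    also have "\<dots> = (\<Prod>j\<in>UNIV. ennreal (u $ j - l $ j))"
      using prod.reindex_bij_betw[OF bij_Abs_wo, of "\<lambda>j. ennreal (u $ j - l $ j)"] by simp
    also have "\<dots> = emeasure lborel (box l u)"
      using lu by (subst emeasure_lborel_box_cart) auto
    also have "\<dots> = (\<Prod>b\<in>Basis. (u - l) \<bullet> b)"
      using le by (rule emeasure_lborel_box)
    finally show "emeasure (distr lborel borel R) (box l u) = ennreal (\<Prod>b\<in>Basis. (u - l) \<bullet> b)" .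
  qed simp
  have image: "R ` X \<in> sets borel" "measure lborel (R ` X) = measure lborel X" if "X \<in> sets borel" for X
  proof -
    have eq: "R ` X = R' -` X"
      using RR' R'R by (auto simp: image_iff) metis
    show "R ` X \<in> sets borel"
      unfolding eq using that measurable_sets[of R' borel borel X] by simp
    moreover have "R -` (R ` X) = X"
      using R'R by (auto simp: image_iff) metis
    ultimately show "measure lborel (R ` X) = measure lborel X"
      by (subst lb) (simp add: measure_distr)
  qed
  define M' where "M' = (\<chi> i j. M $ Rep_wo i $ Rep_wo j)"
  have "(\<Sum>j\<in>UNIV. M $ Rep_wo i $ Rep_wo j * x $ Rep_wo j) = (\<Sum>j\<in>UNIV. M $ Rep_wo i $ j * x $ j)"
    for i and x :: "real^'n"
    by (rule sum_Rep_wo)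
  then have "M' *v R x = R (M *v x)" for x
    by (simp add: M'_def R_def vec_eq_iff matrix_vector_mult_def)
  then have im: "R ` (*v) M ` W = (*v) M' ` R ` W"
    by (simp add: image_image)
  have "bounded (R ` W)"
    using linR W(2) by (intro bounded_linear_image) (simp_all add: linear_conv_bounded_linear)
  then have "R ` W \<in> lmeasurable"
    using image(1)[OF W(1)] by (intro bounded_set_imp_lmeasurable) auto
  then have "measure lebesgue ((*v) M' ` R ` W) = \<bar>det M'\<bar> * measure lebesgue (R ` W)"
    using measure_linear_image[of "(*v) M'" "R ` W"] by simp
  moreover have "(*v) M' ` R ` W \<in> sets borel"
    using image(1)[OF MW] unfolding im .
  ultimately have "measure lborel (R ` (*v) M ` W) = \<bar>det M\<bar> * measure lborel (R ` W)"
    unfolding im using image(1)[OF W(1)] by (simp add: M'_def det_Rep_wo measure_completion)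
  then show ?thesis
    using image(2)[OF MW] image(2)[OF W(1)] by simp
qed

section \<open>Plans given by square integrable densities\<close>

lemma integrable_mult_of_squares:
  fixes f g :: "'a \<Rightarrow> real"
  assumes [measurable]: "f \<in> borel_measurable M" "g \<in> borel_measurable M"
    and "integrable M (\<lambda>x. (f x)\<^sup>2)" "integrable M (\<lambda>x. (g x)\<^sup>2)"
  shows "integrable M (\<lambda>x. f x * g x)"
proof (rule Bochner_Integration.integrable_bound[where f="\<lambda>x. (f x)\<^sup>2 + (g x)\<^sup>2"])
  show "AE x in M. norm (f x * g x) \<le> norm ((f x)\<^sup>2 + (g x)\<^sup>2)"
  proof (rule AE_I2)
    fix x
    have "0 \<le> (\<bar>f x\<bar> - \<bar>g x\<bar>)\<^sup>2"
      by simp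
    then have "2 * (\<bar>f x\<bar> * \<bar>g x\<bar>) \<le> (f x)\<^sup>2 + (g x)\<^sup>2"
      unfolding power2_diff by simp
    moreover have "0 \<le> \<bar>f x\<bar> * \<bar>g x\<bar>" by simp
    ultimately show "norm (f x * g x) \<le> norm ((f x)\<^sup>2 + (g x)\<^sup>2)"
      unfolding real_norm_def abs_mult by linarith
  qed
qed (use assms in auto)

lemma (in finite_measure) integrable_of_square:
  fixes f :: "'a \<Rightarrow> real"
  assumes "f \<in> borel_measurable M" "integrable M (\<lambda>x. (f x)\<^sup>2)"
  shows "integrable M f"
  using integrable_mult_of_squares[of f M "\<lambda>_. 1"] assms by simp

lemma integrable_square_add:
  fixes f g :: "'a \<Rightarrow> real"
  assumes "f \<in> borel_measurable M" "g \<in> borel_measurable M"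
    and "integrable M (\<lambda>x. (f x)\<^sup>2)" "integrable M (\<lambda>x. (g x)\<^sup>2)"
  shows "integrable M (\<lambda>x. (f x + g x)\<^sup>2)"
  using assms integrable_mult_of_squares[OF assms]
  by (simp add: power2_sum mult.assoc)

lemma integrable_square_cmult:
  fixes f :: "'a \<Rightarrow> real"
  shows "integrable M (\<lambda>x. (f x)\<^sup>2) \<Longrightarrow> integrable M (\<lambda>x. (c * f x)\<^sup>2)"
  by (simp add: power_mult_distrib)

lemma integrable_square_sum:
  fixes f :: "'i \<Rightarrow> 'a \<Rightarrow> real"
  assumes "finite I" "\<And>i. i \<in> I \<Longrightarrow> f i \<in> borel_measurable M"
    and "\<And>i. i \<in> I \<Longrightarrow> integrable M (\<lambda>x. (f i x)\<^sup>2)"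
  shows "integrable M (\<lambda>x. (\<Sum>i\<in>I. f i x)\<^sup>2)"
  using assms
proof (induction I)
  case (insert i I)
  then show ?case
    by (simp, intro integrable_square_add borel_measurable_sum) auto
qed simp

text \<open>Turns domination between measures into a density bounded at every point, which later
  keeps competitors nonnegative. The Radon-Nikodym density exceeds \<open>w\<close> only on a null
  set, because the excess has integral zero over the set \<open>B\<close> where it occurs.\<close>

lemma (in sigma_finite_measure) dominated_density:
  fixes w :: "'a \<Rightarrow> real"
  assumes sets: "sets N = sets M"
    and w[measurable]: "w \<in> borel_measurable M" and w0: "\<And>x. 0 \<le> w x" and wi: "integrable M w"
    and le: "\<And>B. B \<in> sets M \<Longrightarrow> emeasure N B \<le> emeasure (density M (\<lambda>x. ennreal (w x))) B"
  obtains u :: "'a \<Rightarrow> real"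
    where "u \<in> borel_measurable M" "\<And>x. 0 \<le> u x" "\<And>x. u x \<le> w x" "N = density M (\<lambda>x. ennreal (u x))"
proof -
  have "absolutely_continuous M N"
    unfolding absolutely_continuous_def
  proof
    fix B assume B: "B \<in> null_sets M"
    then have "emeasure (density M (\<lambda>x. ennreal (w x))) B = 0"
      using absolutely_continuousI_density[OF measurable_compose[OF w measurable_ennreal]]
      by (auto simp: absolutely_continuous_def null_sets_def)
    then show "B \<in> null_sets N"
      using le[of B] B sets by (auto simp: null_sets_def)
  qed
  then obtain f where f[measurable]: "f \<in> borel_measurable M" and N: "density M f = N"
    using Radon_Nikodym sets by blast
  define B where "B = {x\<in>space M. ennreal (w x) < f x}"
  have B[measurable]: "B \<in> sets M"
    unfolding B_def by measurable
  have fin: "(\<integral>\<^sup>+x. ennreal (w x) * indicator B x \<partial>M) < \<infinity>"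
  proof -
    have "(\<integral>\<^sup>+x. ennreal (w x) * indicator B x \<partial>M) \<le> (\<integral>\<^sup>+x. ennreal (w x) \<partial>M)"
      by (intro nn_integral_mono) (auto simp: indicator_def)
    also have "\<dots> < \<infinity>"
      using wi w0 by (simp add: nn_integral_eq_integral)
    finally show ?thesis .
  qed
  have "(\<integral>\<^sup>+x. f x * indicator B x - ennreal (w x) * indicator B x \<partial>M) =
      (\<integral>\<^sup>+x. f x * indicator B x \<partial>M) - (\<integral>\<^sup>+x. ennreal (w x) * indicator B x \<partial>M)"
    using fin by (intro nn_integral_diff) (auto simp: B_def indicator_def)
  also have "\<dots> = 0"
    using le[OF B] fin by (auto simp: N[symmetric] emeasure_density diff_eq_0_iff_ennreal)
  finally have "AE x in M. f x * indicator B x - ennreal (w x) * indicator B x = 0"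
    by (subst (asm) nn_integral_0_iff_AE) auto
  then have AEle: "AE x in M. f x \<le> ennreal (w x)"
    using AE_space
  proof eventually_elim
    case (elim x)
    show ?case
    proof (rule ccontr)
      assume "\<not> f x \<le> ennreal (w x)"
      with elim have "x \<in> B" by (auto simp: B_def)
      with elim have "f x - ennreal (w x) = 0" by simp
      with \<open>\<not> f x \<le> ennreal (w x)\<close> show False
        by (auto simp: diff_eq_0_iff_ennreal)
    qed
  qed
  \<comment> \<open>Cutting at \<open>w\<close> changes the density only on a null set and makes the
    bound hold everywhere.\<close>
  define u where "u x = min (enn2real (f x)) (w x)" for x
  have [measurable]: "u \<in> borel_measurable M"
    unfolding u_def by measurable
  have "density M f = density M (\<lambda>x. ennreal (u x))"
  proof (rule density_cong)
    show "AE x in M. f x = ennreal (u x)"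
      using AEle
    proof eventually_elim
      case (elim x)
      then have "f x < \<infinity>"
        using ennreal_less_top le_less_trans by fastforce
      with elim show ?case
        using w0[of x] enn2real_leI[of "w x" "f x"] by (simp add: u_def min_def)
    qed
  qed auto
  then show thesis
    using that[of u] w0 N by (auto simp: u_def)
qed

section \<open>Couplings with square integrable densities\<close>

lemma distr_pair_snd:
  assumes "prob_space A" "sigma_finite_measure B"
  shows "distr (A \<Otimes>\<^sub>M B) B snd = B"
proof (rule measure_eqI)
  interpret A: prob_space A by fact
  interpret B: sigma_finite_measure B by fact
  fix X assume "X \<in> sets (distr (A \<Otimes>\<^sub>M B) B snd)"
  then have X: "X \<in> sets B" by simp
  then have "snd -` X \<inter> space (A \<Otimes>\<^sub>M B) = space A \<times> X"
    by (auto simp: space_pair_measure dest: sets.sets_into_space)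
  with X show "emeasure (distr (A \<Otimes>\<^sub>M B) B snd) X = emeasure B X"
    by (simp add: emeasure_distr B.emeasure_pair_measure_Times A.emeasure_space_1)
qed simp

text \<open>A coupling is represented by a real function that is nonnegative at every point, so that
  competitors can be formed by pointwise arithmetic; square integrability is the finiteness of the
  regularizing term.\<close>

definition plan_density :: "'a measure \<Rightarrow> 'b measure \<Rightarrow> ('a \<times> 'b \<Rightarrow> real) \<Rightarrow> bool" where
  "plan_density M N h \<longleftrightarrow> h \<in> borel_measurable (M \<Otimes>\<^sub>M N) \<and> (\<forall>z. 0 \<le> h z) \<and>
     integrable (M \<Otimes>\<^sub>M N) (\<lambda>z. (h z)\<^sup>2) \<and>
     distr (density (M \<Otimes>\<^sub>M N) (\<lambda>z. ennreal (h z))) M fst = M \<and>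
     distr (density (M \<Otimes>\<^sub>M N) (\<lambda>z. ennreal (h z))) N snd = N"

lemma plan_densityD:
  assumes "plan_density M N h"
  shows plan_density_measurable: "h \<in> borel_measurable (M \<Otimes>\<^sub>M N)"
    and plan_density_nonneg: "0 \<le> h z"
    and plan_density_square: "integrable (M \<Otimes>\<^sub>M N) (\<lambda>z. (h z)\<^sup>2)"
    and plan_density_fst: "distr (density (M \<Otimes>\<^sub>M N) (\<lambda>z. ennreal (h z))) M fst = M"
    and plan_density_snd: "distr (density (M \<Otimes>\<^sub>M N) (\<lambda>z. ennreal (h z))) N snd = N"
  using assms unfolding plan_density_def by blast+

lemma plan_density_swap:
  assumes "sigma_finite_measure M" "sigma_finite_measure N" and h: "plan_density M N h"
  shows "plan_density N M (\<lambda>z. h (snd z, fst z))"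
proof -
  interpret pair_sigma_finite N M
    by (intro pair_sigma_finite.intro assms)
  interpret MN: pair_sigma_finite M N
    by (intro pair_sigma_finite.intro assms)
  note [measurable] = plan_density_measurable[OF h]
  have eq: "density (N \<Otimes>\<^sub>M M) (\<lambda>z. ennreal (h (snd z, fst z))) =
      distr (density (M \<Otimes>\<^sub>M N) (\<lambda>z. ennreal (h z))) (N \<Otimes>\<^sub>M M) (\<lambda>(x, y). (y, x))"
    by (subst distr_pair_swap, subst density_distr)
      (auto intro!: distr_cong density_cong simp: case_prod_beta)
  have "integrable (distr (M \<Otimes>\<^sub>M N) (N \<Otimes>\<^sub>M M) (\<lambda>(x, y). (y, x))) (\<lambda>z. (h (snd z, fst z))\<^sup>2)"
    using plan_density_square[OF h] by (subst integrable_distr_eq) (auto simp: case_prod_beta)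
  then have "integrable (N \<Otimes>\<^sub>M M) (\<lambda>z. (h (snd z, fst z))\<^sup>2)"
    by (subst distr_pair_swap)
  then show ?thesis
    unfolding plan_density_def eq using plan_densityD[OF h]
    by (auto simp: distr_distr comp_def case_prod_beta)
qed

context pair_prob_space
begin

lemma plan_density_prob:
  assumes "plan_density M1 M2 h"
  shows "prob_space (density (M1 \<Otimes>\<^sub>M M2) (\<lambda>z. ennreal (h z)))"
  by (rule prob_space_distrD[of fst _ M1])
    (use plan_density_fst[OF assms] M1.prob_space_axioms in auto)

lemma plan_density_integrable: "plan_density M1 M2 h \<Longrightarrow> integrable (M1 \<Otimes>\<^sub>M M2) h"
  by (rule integrable_of_square) (auto dest: plan_densityD)

lemma plan_density_integral_fst:
  fixes g :: "'a \<Rightarrow> real"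
  assumes h: "plan_density M1 M2 h" and [measurable]: "g \<in> borel_measurable M1"
  shows "(\<integral>z. h z * g (fst z) \<partial>(M1 \<Otimes>\<^sub>M M2)) = (\<integral>x. g x \<partial>M1)"
proof -
  note [measurable] = plan_density_measurable[OF h]
  have "(\<integral>x. g x \<partial>M1) = (\<integral>z. g (fst z) \<partial>density (M1 \<Otimes>\<^sub>M M2) (\<lambda>z. ennreal (h z)))"
    by (subst plan_density_fst[OF h, symmetric], subst integral_distr) auto
  also have "\<dots> = (\<integral>z. h z * g (fst z) \<partial>(M1 \<Otimes>\<^sub>M M2))"
    by (subst integral_density) (auto simp: plan_density_nonneg[OF h])
  finally show ?thesis ..
qed

lemma plan_density_integral_snd:
  fixes g :: "'b \<Rightarrow> real"
  assumes h: "plan_density M1 M2 h" and [measurable]: "g \<in> borel_measurable M2"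
  shows "(\<integral>z. h z * g (snd z) \<partial>(M1 \<Otimes>\<^sub>M M2)) = (\<integral>x. g x \<partial>M2)"
proof -
  note [measurable] = plan_density_measurable[OF h]
  have "(\<integral>x. g x \<partial>M2) = (\<integral>z. g (snd z) \<partial>density (M1 \<Otimes>\<^sub>M M2) (\<lambda>z. ennreal (h z)))"
    by (subst plan_density_snd[OF h, symmetric], subst integral_distr) auto
  also have "\<dots> = (\<integral>z. h z * g (snd z) \<partial>(M1 \<Otimes>\<^sub>M M2))"
    by (subst integral_density) (auto simp: plan_density_nonneg[OF h])
  finally show ?thesis ..
qed

text \<open>Marginals are tested on indicators through real integrals, which are linear in signed
  combinations of densities; this is the form in which competitors arise.\<close>

lemma plan_densityI:
  assumes [measurable]: "h \<in> borel_measurable (M1 \<Otimes>\<^sub>M M2)" and h0: "\<And>z. 0 \<le> h z"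
    and sq: "integrable (M1 \<Otimes>\<^sub>M M2) (\<lambda>z. (h z)\<^sup>2)"
    and fst: "\<And>B. B \<in> sets M1 \<Longrightarrow> (\<integral>z. h z * indicator B (fst z) \<partial>(M1 \<Otimes>\<^sub>M M2)) = measure M1 B"
    and snd: "\<And>B. B \<in> sets M2 \<Longrightarrow> (\<integral>z. h z * indicator B (snd z) \<partial>(M1 \<Otimes>\<^sub>M M2)) = measure M2 B"
  shows "plan_density M1 M2 h"
proof -
  have hi: "integrable (M1 \<Otimes>\<^sub>M M2) h"
    by (rule integrable_of_square[OF _ sq]) measurable
  have *: "emeasure (distr (density (M1 \<Otimes>\<^sub>M M2) (\<lambda>z. ennreal (h z))) N X) B =
      ennreal (\<integral>z. h z * indicator B (X z) \<partial>(M1 \<Otimes>\<^sub>M M2))"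
    if [measurable]: "X \<in> (M1 \<Otimes>\<^sub>M M2) \<rightarrow>\<^sub>M N" "B \<in> sets N" for X B and N :: "'c measure"
  proof -
    have "emeasure (distr (density (M1 \<Otimes>\<^sub>M M2) (\<lambda>z. ennreal (h z))) N X) B =
       (\<integral>\<^sup>+z. ennreal (h z) * indicator (X -` B \<inter> space (M1 \<Otimes>\<^sub>M M2)) z \<partial>(M1 \<Otimes>\<^sub>M M2))"
      by (subst emeasure_distr) (auto simp: emeasure_density)
    also have "\<dots> = (\<integral>\<^sup>+z. ennreal (h z * indicator B (X z)) \<partial>(M1 \<Otimes>\<^sub>M M2))"
      by (intro nn_integral_cong) (auto simp: indicator_def)
    also have "\<dots> = ennreal (\<integral>z. h z * indicator B (X z) \<partial>(M1 \<Otimes>\<^sub>M M2))"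
    proof (rule nn_integral_eq_integral)
      show "integrable (M1 \<Otimes>\<^sub>M M2) (\<lambda>z. h z * indicator B (X z))"
        by (rule Bochner_Integration.integrable_bound[OF hi]) (auto simp: indicator_def)
    qed (auto simp: h0)
    finally show ?thesis .
  qed
  show ?thesis
    unfolding plan_density_def
  proof (intro conjI measure_eqI)
    fix B assume "B \<in> sets (distr (density (M1 \<Otimes>\<^sub>M M2) (\<lambda>z. ennreal (h z))) M1 fst)"
    then show "emeasure (distr (density (M1 \<Otimes>\<^sub>M M2) (\<lambda>z. ennreal (h z))) M1 fst) B = emeasure M1 B"
      by (subst *) (auto simp: fst M1.emeasure_eq_measure)
  next
    fix B assume "B \<in> sets (distr (density (M1 \<Otimes>\<^sub>M M2) (\<lambda>z. ennreal (h z))) M2 snd)"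
    then show "emeasure (distr (density (M1 \<Otimes>\<^sub>M M2) (\<lambda>z. ennreal (h z))) M2 snd) B = emeasure M2 B"
      by (subst *) (auto simp: snd M2.emeasure_eq_measure)
  qed (use assms in auto)
qed

text \<open>The inner integral is the density of the first marginal with respect to
  \<open>M1\<close>; since that marginal is \<open>M1\<close> itself, uniqueness of densities makes
  it one almost everywhere.\<close>

lemma plan_density_section_fst:
  assumes h: "plan_density M1 M2 h"
  shows "AE x in M1. (\<integral>\<^sup>+y. ennreal (h (x, y)) \<partial>M2) = 1"
proof -
  note [measurable] = plan_density_measurable[OF h]
  have "density M1 (\<lambda>x. \<integral>\<^sup>+y. ennreal (h (x, y)) \<partial>M2) = density M1 (\<lambda>_. 1)"
  proof (rule measure_eqI)
    fix B assume "B \<in> sets (density M1 (\<lambda>x. \<integral>\<^sup>+y. ennreal (h (x, y)) \<partial>M2))"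
    then have [measurable]: "B \<in> sets M1" by simp
    have "emeasure M1 B = (\<integral>\<^sup>+z. ennreal (h z) * indicator (fst -` B \<inter> space (M1 \<Otimes>\<^sub>M M2)) z \<partial>(M1 \<Otimes>\<^sub>M M2))"
      by (subst plan_density_fst[OF h, symmetric], subst emeasure_distr) (auto simp: emeasure_density)
    also have "\<dots> = (\<integral>\<^sup>+z. ennreal (h z) * indicator B (fst z) \<partial>(M1 \<Otimes>\<^sub>M M2))"
      by (intro nn_integral_cong) (auto simp: indicator_def)
    also have "\<dots> = (\<integral>\<^sup>+x. \<integral>\<^sup>+y. ennreal (h (x, y)) * indicator B x \<partial>M2 \<partial>M1)"
      by (subst M2.nn_integral_fst[symmetric]) auto
    also have "\<dots> = (\<integral>\<^sup>+x. (\<integral>\<^sup>+y. ennreal (h (x, y)) \<partial>M2) * indicator B x \<partial>M1)"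
      by (intro nn_integral_cong nn_integral_multc) auto
    finally show "emeasure (density M1 (\<lambda>x. \<integral>\<^sup>+y. ennreal (h (x, y)) \<partial>M2)) B = emeasure (density M1 (\<lambda>_. 1)) B"
      by (simp add: emeasure_density)
  qed simp
  then show ?thesis
    by (subst (asm) M1.density_unique_iff) auto
qed

text \<open>Removing the fraction \<open>1 / card I\<close> of the mass transported along \<open>p i\<close> and sending it along
  \<open>q i\<close> produces a competitor.\<close>
lemma plan_density_exchange:
  assumes h: "plan_density M1 M2 h"
    and [measurable]: "G \<in> borel_measurable (M1 \<Otimes>\<^sub>M M2)" and G2: "integrable (M1 \<Otimes>\<^sub>M M2) (\<lambda>z. (G z)\<^sup>2)"
    and opt: "\<And>h'. plan_density M1 M2 h' \<Longrightarrow>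
      (\<integral>z. G z * h z \<partial>(M1 \<Otimes>\<^sub>M M2)) \<le> (\<integral>z. G z * h' z \<partial>(M1 \<Otimes>\<^sub>M M2))"
    and I: "finite I" "I \<noteq> {}"
    and p[measurable]: "\<And>i. i \<in> I \<Longrightarrow> p i \<in> \<Gamma> \<rightarrow>\<^sub>M M1 \<Otimes>\<^sub>M M2"
    and q[measurable]: "\<And>i. i \<in> I \<Longrightarrow> q i \<in> \<Gamma> \<rightarrow>\<^sub>M M1 \<Otimes>\<^sub>M M2"
    and \<Gamma>: "finite_measure \<Gamma>"
    and pdom: "\<And>i B. i \<in> I \<Longrightarrow> B \<in> sets (M1 \<Otimes>\<^sub>M M2) \<Longrightarrow>
      emeasure (distr \<Gamma> (M1 \<Otimes>\<^sub>M M2) (p i)) B \<le> emeasure (density (M1 \<Otimes>\<^sub>M M2) (\<lambda>z. ennreal (h z))) B"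
    and qdom: "\<And>i B. i \<in> I \<Longrightarrow> B \<in> sets (M1 \<Otimes>\<^sub>M M2) \<Longrightarrow>
      emeasure (distr \<Gamma> (M1 \<Otimes>\<^sub>M M2) (q i)) B \<le> emeasure (M1 \<Otimes>\<^sub>M M2) B"
    and fst: "\<And>\<omega> g. (\<Sum>i\<in>I. g (fst (p i \<omega>)) :: real) = (\<Sum>i\<in>I. g (fst (q i \<omega>)))"
    and snd: "\<And>\<omega> g. (\<Sum>i\<in>I. g (snd (p i \<omega>)) :: real) = (\<Sum>i\<in>I. g (snd (q i \<omega>)))"
  shows "i \<in> I \<Longrightarrow> integrable \<Gamma> (\<lambda>\<omega>. G (p i \<omega>))"
    and "i \<in> I \<Longrightarrow> integrable \<Gamma> (\<lambda>\<omega>. G (q i \<omega>))"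
    and "(\<Sum>i\<in>I. \<integral>\<omega>. G (p i \<omega>) \<partial>\<Gamma>) \<le> (\<Sum>i\<in>I. \<integral>\<omega>. G (q i \<omega>) \<partial>\<Gamma>)"
proof -
  let ?P = "M1 \<Otimes>\<^sub>M M2"
  interpret \<Gamma>: finite_measure \<Gamma> by fact
  note hm[measurable] = plan_density_measurable[OF h]
  note h0 = plan_density_nonneg[OF h]
  have one: "density ?P (\<lambda>x. ennreal 1) = ?P"
    by (simp add: density_1)
  have "\<exists>u. u \<in> borel_measurable ?P \<and> (\<forall>x. 0 \<le> u x) \<and> (\<forall>x. u x \<le> h x) \<and>
      distr \<Gamma> ?P (p i) = density ?P (\<lambda>x. ennreal (u x))" if "i \<in> I" for i
    using dominated_density[of "distr \<Gamma> ?P (p i)" h] hm h0 plan_density_integrable[OF h] pdom[OF that]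
    by (metis sets_distr)
  then obtain u where u: "\<And>i. i \<in> I \<Longrightarrow> u i \<in> borel_measurable ?P" "\<And>i x. i \<in> I \<Longrightarrow> 0 \<le> u i x"
    "\<And>i x. i \<in> I \<Longrightarrow> u i x \<le> h x"
    "\<And>i. i \<in> I \<Longrightarrow> distr \<Gamma> ?P (p i) = density ?P (\<lambda>x. ennreal (u i x))"
    by metis
  \<comment> \<open>The laws of the new pairs are dominated by the product measure, so their
    densities are bounded by one and the competitor stays square integrable.\<close>
  have "\<exists>u. u \<in> borel_measurable ?P \<and> (\<forall>x. 0 \<le> u x) \<and> (\<forall>x. u x \<le> (1::real)) \<and>
      distr \<Gamma> ?P (q i) = density ?P (\<lambda>x. ennreal (u x))" if "i \<in> I" for i
    using dominated_density[of "distr \<Gamma> ?P (q i)" "\<lambda>_. 1"] qdom[OF that] unfolding one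
    by (metis borel_measurable_const finite_measure.integrable_const finite_measure_axioms sets_distr zero_le_one)
  then obtain v where v: "\<And>i. i \<in> I \<Longrightarrow> v i \<in> borel_measurable ?P" "\<And>i x. i \<in> I \<Longrightarrow> 0 \<le> v i x"
    "\<And>i x. i \<in> I \<Longrightarrow> v i x \<le> (1::real)"
    "\<And>i. i \<in> I \<Longrightarrow> distr \<Gamma> ?P (q i) = density ?P (\<lambda>x. ennreal (v i x))"
    by metis
  note [measurable] = u(1) v(1)
  have u2: "integrable ?P (\<lambda>z. (u i z)\<^sup>2)" if "i \<in> I" for i
    using plan_density_square[OF h]
    by (rule Bochner_Integration.integrable_bound)
      (use that u h0 in \<open>auto intro!: power_mono AE_I2\<close>)
  have v2: "integrable ?P (\<lambda>z. (v i z)\<^sup>2)" if "i \<in> I" for i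
    by (rule Bochner_Integration.integrable_bound[of _ "\<lambda>_. 1::real"])
      (use that v in \<open>auto intro!: power_le_one AE_I2\<close>)
  have Gu: "(\<integral>\<omega>. f (p i \<omega>) \<partial>\<Gamma>) = (\<integral>z. f z * u i z \<partial>?P)"
    if i: "i \<in> I" and [measurable]: "f \<in> borel_measurable ?P" for f :: "_ \<Rightarrow> real" and i
  proof -
    have "(\<integral>\<omega>. f (p i \<omega>) \<partial>\<Gamma>) = (\<integral>z. f z \<partial>distr \<Gamma> ?P (p i))"
      using i by (subst integral_distr) auto
    also have "\<dots> = (\<integral>z. f z * u i z \<partial>?P)"
      unfolding u(4)[OF i] using i u(2) by (subst integral_density) (auto simp: mult.commute)
    finally show ?thesis .
  qed
  have Gv: "(\<integral>\<omega>. f (q i \<omega>) \<partial>\<Gamma>) = (\<integral>z. f z * v i z \<partial>?P)"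
    if i: "i \<in> I" and [measurable]: "f \<in> borel_measurable ?P" for f :: "_ \<Rightarrow> real" and i
  proof -
    have "(\<integral>\<omega>. f (q i \<omega>) \<partial>\<Gamma>) = (\<integral>z. f z \<partial>distr \<Gamma> ?P (q i))"
      using i by (subst integral_distr) auto
    also have "\<dots> = (\<integral>z. f z * v i z \<partial>?P)"
      unfolding v(4)[OF i] using i v(2) by (subst integral_density) (auto simp: mult.commute)
    finally show ?thesis .
  qed
  have iGu: "integrable ?P (\<lambda>z. G z * u i z)" and iGv: "integrable ?P (\<lambda>z. G z * v i z)" if "i \<in> I" for i
    using that by (auto intro!: integrable_mult_of_squares G2 u2 v2)
  show "integrable \<Gamma> (\<lambda>\<omega>. G (p i \<omega>))" if i: "i \<in> I"
  proof -
    have "integrable (distr \<Gamma> ?P (p i)) G"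
      unfolding u(4)[OF i] using i u(2) iGu[OF i] by (subst integrable_density) (auto simp: mult.commute)
    then show ?thesis
      using i by (simp add: integrable_distr_eq)
  qed
  show "integrable \<Gamma> (\<lambda>\<omega>. G (q i \<omega>))" if i: "i \<in> I"
  proof -
    have "integrable (distr \<Gamma> ?P (q i)) G"
      unfolding v(4)[OF i] using i v(2) iGv[OF i] by (subst integrable_density) (auto simp: mult.commute)
    then show ?thesis
      using i by (simp add: integrable_distr_eq)
  qed
  \<comment> \<open>Each \<open>u i\<close> is below \<open>h\<close>, but they may all charge the
    same place, so only \<open>card I * h\<close> bounds their sum; this dictates the
    fraction.\<close>
  define t where "t = 1 / real (card I)"
  have t: "t > 0" "t * real (card I) = 1"
    using I by (auto simp: t_def card_gt_0_iff)
  define h' where "h' z = h z + t * ((\<Sum>i\<in>I. v i z) + (- 1) * (\<Sum>i\<in>I. u i z))" for z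
  have h'm[measurable]: "h' \<in> borel_measurable ?P"
    unfolding h'_def by measurable
  \<comment> \<open>Test functions balanced between \<open>p\<close> and \<open>q\<close> do not
    notice the exchange. Indicators of one coordinate are balanced by the hypotheses
    \<open>fst\<close> and \<open>snd\<close>, which gives the marginals of
    \<open>h'\<close>.\<close>
  have ind: "(\<integral>z. h' z * g z \<partial>?P) = (\<integral>z. h z * g z \<partial>?P)"
    if [measurable]: "g \<in> borel_measurable ?P" and g: "\<And>z. \<bar>g z\<bar> \<le> 1"
      and eq: "\<And>\<omega>. (\<Sum>i\<in>I. g (p i \<omega>)) = (\<Sum>i\<in>I. g (q i \<omega>))" for g :: "_ \<Rightarrow> real"
  proof -
    have g2: "integrable ?P (\<lambda>z. (g z)\<^sup>2)"
      by (rule Bochner_Integration.integrable_bound[of _ "\<lambda>_. 1::real"])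
        (use g in \<open>auto intro!: AE_I2 simp: abs_square_le_1\<close>)
    have i: "integrable ?P (\<lambda>z. h z * g z)" "\<And>i. i \<in> I \<Longrightarrow> integrable ?P (\<lambda>z. g z * u i z)"
      "\<And>i. i \<in> I \<Longrightarrow> integrable ?P (\<lambda>z. g z * v i z)"
      by (auto intro!: integrable_mult_of_squares g2 u2 v2 plan_density_square[OF h])
    have int: "integrable \<Gamma> (\<lambda>\<omega>. g (X \<omega>))" if [measurable]: "X \<in> \<Gamma> \<rightarrow>\<^sub>M ?P" for X
      by (rule \<Gamma>.integrable_const_bound[of _ 1]) (use g in auto)
    have "(\<integral>z. h' z * g z \<partial>?P) =
        (\<integral>z. h z * g z + t * ((\<Sum>i\<in>I. g z * v i z) - (\<Sum>i\<in>I. g z * u i z)) \<partial>?P)"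
      by (intro Bochner_Integration.integral_cong)
        (auto simp: h'_def algebra_simps sum_distrib_left sum_negf)
    also have "\<dots> = (\<integral>z. h z * g z \<partial>?P) + t * ((\<Sum>i\<in>I. \<integral>\<omega>. g (q i \<omega>) \<partial>\<Gamma>) - (\<Sum>i\<in>I. \<integral>\<omega>. g (p i \<omega>) \<partial>\<Gamma>))"
      using i by (simp add: Gu Gv)
    also have "(\<Sum>i\<in>I. \<integral>\<omega>. g (q i \<omega>) \<partial>\<Gamma>) = (\<integral>\<omega>. (\<Sum>i\<in>I. g (q i \<omega>)) \<partial>\<Gamma>)"
      by (rule Bochner_Integration.integral_sum[symmetric]) (auto intro!: int)
    also have "\<dots> = (\<Sum>i\<in>I. \<integral>\<omega>. g (p i \<omega>) \<partial>\<Gamma>)"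
      unfolding eq[symmetric] by (rule Bochner_Integration.integral_sum) (auto intro!: int)
    finally show ?thesis
      by simp
  qed
  have plan: "plan_density M1 M2 h'"
  proof (rule plan_densityI)
    fix z
    have "(\<Sum>i\<in>I. u i z) \<le> real (card I) * h z"
      using sum_bounded_above[of I "\<lambda>i. u i z" "h z"] u(3) by simp
    then have "t * (\<Sum>i\<in>I. u i z) \<le> t * (real (card I) * h z)"
      using t by (intro mult_left_mono) auto
    also have "\<dots> = h z"
      using t by (simp flip: mult.assoc)
    finally have "t * (\<Sum>i\<in>I. u i z) \<le> h z" .
    moreover have "t * (\<Sum>i\<in>I. v i z) \<ge> 0"
      using t v(2) by (simp add: sum_nonneg)
    ultimately show "0 \<le> h' z"
      by (simp add: h'_def algebra_simps)
  next
    show "integrable ?P (\<lambda>z. (h' z)\<^sup>2)"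
      unfolding h'_def
      by (intro integrable_square_add integrable_square_cmult integrable_square_sum
          plan_density_square[OF h] u2 v2 I borel_measurable_sum borel_measurable_times) auto
  next
    fix B assume [measurable]: "B \<in> sets M1"
    show "(\<integral>z. h' z * indicator B (fst z) \<partial>?P) = measure M1 B"
      using ind[of "\<lambda>z. indicator B (fst z)"] fst[of "indicator B"]
        plan_density_integral_fst[OF h, of "indicator B"] by simp
  next
    fix B assume [measurable]: "B \<in> sets M2"
    show "(\<integral>z. h' z * indicator B (snd z) \<partial>?P) = measure M2 B"
      using ind[of "\<lambda>z. indicator B (snd z)"] snd[of "indicator B"]
        plan_density_integral_snd[OF h, of "indicator B"] by simp
  qed measurable
  have "(\<integral>z. G z * h z \<partial>?P) \<le> (\<integral>z. G z * h' z \<partial>?P)"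
    by (rule opt[OF plan])
  also have "\<dots> = (\<integral>z. G z * h z + t * ((\<Sum>i\<in>I. G z * v i z) - (\<Sum>i\<in>I. G z * u i z)) \<partial>?P)"
    by (intro Bochner_Integration.integral_cong) (auto simp: h'_def algebra_simps sum_distrib_left sum_negf)
  also have "\<dots> = (\<integral>z. G z * h z \<partial>?P) + t * ((\<Sum>i\<in>I. \<integral>\<omega>. G (q i \<omega>) \<partial>\<Gamma>) - (\<Sum>i\<in>I. \<integral>\<omega>. G (p i \<omega>) \<partial>\<Gamma>))"
    using iGu iGv integrable_mult_of_squares[of G ?P h] G2 plan_density_square[OF h] by (simp add: Gu Gv)
  finally show "(\<Sum>i\<in>I. \<integral>\<omega>. G (p i \<omega>) \<partial>\<Gamma>) \<le> (\<Sum>i\<in>I. \<integral>\<omega>. G (q i \<omega>) \<partial>\<Gamma>)"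
    using t by (simp add: zero_le_mult_iff)
qed

end

section \<open>Regularized self-transport\<close>

text \<open>Maps applied to independent factors stay independent. This is why the new pairs of the
  exchange have exactly the product law: their two coordinates come from different samples.\<close>

lemma distr_pair_independent:
  assumes "prob_space A" "prob_space B" and f: "f \<in> A \<rightarrow>\<^sub>M M" and g: "g \<in> B \<rightarrow>\<^sub>M N"
    and "distr A M f = M" "distr B N g = N"
  shows "distr (A \<Otimes>\<^sub>M B) (M \<Otimes>\<^sub>M N) (\<lambda>z. (f (fst z), g (snd z))) = M \<Otimes>\<^sub>M N"
proof -
  have "prob_space (distr B N g)"
    using assms by (intro prob_space.prob_space_distr)
  then have "sigma_finite_measure (distr B N g)"
    by (rule prob_space_imp_sigma_finite)
  from pair_measure_distr[OF f g this] show ?thesis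
    unfolding assms(5,6) case_prod_beta by (rule sym)
qed

text \<open>The setting after the change of variables, with \<open>s\<close> in the role of
  multiplication by the root of \<open>A\<close>. Minimality enters through \<open>opt\<close> in
  linearized form, where the cost contains \<open>\<epsilon> * h\<close> itself. Of the geometry
  only the lower bound \<open>mass\<close> on preimages of \<delta>-balls is kept; the bound
  \<open>K\<close> is qualitative and leaves no trace in the final estimate.\<close>

locale self_transport = prob_space M for M :: "'a measure" +
  fixes s :: "'a \<Rightarrow> 'b::euclidean_space" and h :: "'a \<times> 'a \<Rightarrow> real" and \<epsilon> \<delta> K :: real
  assumes s_meas[measurable]: "s \<in> borel_measurable M"
    and s_bounded: "AE x in M. norm (s x) \<le> K"
    and plan: "plan_density M M h"
    and eps: "0 < \<epsilon>" and delta: "0 < \<delta>"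
    and opt: "\<And>h'. plan_density M M h' \<Longrightarrow>
      (\<integral>z. ((norm (s (fst z) - s (snd z)))\<^sup>2 / 2 + \<epsilon> * h z) * h z \<partial>(M \<Otimes>\<^sub>M M))
      \<le> (\<integral>z. ((norm (s (fst z) - s (snd z)))\<^sup>2 / 2 + \<epsilon> * h z) * h' z \<partial>(M \<Otimes>\<^sub>M M))"
    and mass: "AE x in M. \<epsilon> \<le> \<delta>\<^sup>2 * measure M {y\<in>space M. norm (s x - s y) \<le> \<delta>}"
begin

sublocale PP: pair_prob_space M M
  by unfold_locales

abbreviation "P \<equiv> M \<Otimes>\<^sub>M M"
definition "G z = (norm (s (fst z) - s (snd z)))\<^sup>2 / 2 + \<epsilon> * h z"
definition "\<Theta> = density P (\<lambda>z. ennreal (h z))"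

lemmas h_meas[measurable] = plan_density_measurable[OF plan]
lemmas h_nonneg = plan_density_nonneg[OF plan]

lemma G_meas[measurable]: "G \<in> borel_measurable P"
  unfolding G_def by measurable

lemma sets_\<Theta>[measurable_cong]: "sets \<Theta> = sets P"
  by (simp add: \<Theta>_def)

lemma prob_space_\<Theta>: "prob_space \<Theta>"
  unfolding \<Theta>_def by (rule PP.plan_density_prob[OF plan])

lemma AE_fst_snd:
  assumes [measurable]: "Measurable.pred M Q" and "AE x in M. Q x"
  shows "AE z in P. Q (fst z) \<and> Q (snd z)"
proof (rule PP.AE_pair_measure)
  show "AE x in M. AE y in M. Q (fst (x, y)) \<and> Q (snd (x, y))"
    using assms(2)
  proof eventually_elim
    case (elim x)
    show ?case
      using assms(2) by eventually_elim (use elim in simp)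
  qed
qed measurable

lemma dist_bounded: "AE z in P. norm (s (fst z) - s (snd z)) \<le> 2 * K"
proof -
  have "AE z in P. norm (s (fst z)) \<le> K \<and> norm (s (snd z)) \<le> K"
    by (rule AE_fst_snd[OF _ s_bounded]) measurable
  then show ?thesis
  proof eventually_elim
    case (elim z)
    then show ?case
      using norm_triangle_ineq4[of "s (fst z)" "s (snd z)"] by linarith
  qed
qed

lemma cost_square: "integrable P (\<lambda>z. ((norm (s (fst z) - s (snd z)))\<^sup>2 / 2)\<^sup>2)"
proof (rule PP.integrable_const_bound)
  show "AE z in P. norm (((norm (s (fst z) - s (snd z)))\<^sup>2 / 2)\<^sup>2) \<le> ((2 * K)\<^sup>2 / 2)\<^sup>2"
    using dist_bounded
  proof eventually_elim
    case (elim z)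
    have "(norm (s (fst z) - s (snd z)))\<^sup>2 \<le> (2 * K)\<^sup>2"
      using elim by (intro power_mono) auto
    then have "((norm (s (fst z) - s (snd z)))\<^sup>2 / 2)\<^sup>2 \<le> ((2 * K)\<^sup>2 / 2)\<^sup>2"
      using elim by (intro power_mono divide_right_mono) auto
    then show ?case
      by (simp only: real_norm_def abs_power2)
  qed
qed measurable

lemma G_square: "integrable P (\<lambda>z. (G z)\<^sup>2)"
  unfolding G_def
  by (intro integrable_square_add integrable_square_cmult cost_square plan_density_square[OF plan]) measurable

lemma opt_G: "plan_density M M h' \<Longrightarrow> (\<integral>z. G z * h z \<partial>P) \<le> (\<integral>z. G z * h' z \<partial>P)"
  unfolding G_def by (rule opt)

text \<open>The transposed density \<open>k\<close> is a competitor with the same transport cost and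
  the same L2 norm. Testing optimality against it bounds the integral of \<open>h * h\<close> by
  that of \<open>h * k\<close>, so the squared L2 distance of \<open>h\<close> and \<open>k\<close>
  is at most zero.\<close>

lemma h_symmetric: "AE z in P. h (snd z, fst z) = h z"
proof -
  define k where "k z = h (snd z, fst z)" for z
  define C where "C z = (norm (s (fst z) - s (snd z)))\<^sup>2 / 2" for z
  have k: "plan_density M M k"
    unfolding k_def by (intro plan_density_swap plan sigma_finite_measure_axioms)
  note [measurable] = plan_density_measurable[OF k]
  have [measurable]: "C \<in> borel_measurable P"
    unfolding C_def by measurable
  have swap: "(\<integral>z. f (snd z, fst z) \<partial>P) = (\<integral>z. f z \<partial>P)" if "f \<in> borel_measurable P" for f :: "_ \<Rightarrow> real"
    using PP.integral_product_swap[OF that] unfolding case_prod_unfold .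
  have iC: "integrable P (\<lambda>z. C z * f z)" if "plan_density M M f" for f
    by (rule integrable_mult_of_squares)
      (use cost_square that in \<open>auto simp: C_def[abs_def] dest: plan_densityD\<close>)
  have ihh: "integrable P (\<lambda>z. h z * h z)" and ihk: "integrable P (\<lambda>z. h z * k z)"
    and ikk: "integrable P (\<lambda>z. k z * k z)"
    using plan k by (auto intro!: integrable_mult_of_squares dest: plan_densityD)
  have Ck: "(\<integral>z. C z * k z \<partial>P) = (\<integral>z. C z * h z \<partial>P)"
    using swap[of "\<lambda>z. C z * h z"] by (simp add: C_def k_def norm_minus_commute)
  have kk: "(\<integral>z. k z * k z \<partial>P) = (\<integral>z. h z * h z \<partial>P)"
    using swap[of "\<lambda>z. h z * h z"] by (simp add: k_def)
  have "(\<integral>z. C z * h z + \<epsilon> * (h z * h z) \<partial>P) \<le> (\<integral>z. C z * k z + \<epsilon> * (h z * k z) \<partial>P)"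
    using opt_G[OF k] by (simp add: G_def C_def algebra_simps)
  then have "(\<integral>z. C z * h z \<partial>P) + \<epsilon> * (\<integral>z. h z * h z \<partial>P) \<le> (\<integral>z. C z * k z \<partial>P) + \<epsilon> * (\<integral>z. h z * k z \<partial>P)"
    using iC[OF plan] iC[OF k] ihh ihk by simp
  then have le: "(\<integral>z. h z * h z \<partial>P) \<le> (\<integral>z. h z * k z \<partial>P)"
    using eps Ck by simp
  have "(\<integral>z. (h z - k z)\<^sup>2 \<partial>P) = (\<integral>z. h z * h z - 2 * (h z * k z) + k z * k z \<partial>P)"
    by (intro Bochner_Integration.integral_cong) (auto simp: power2_eq_square algebra_simps)
  also have "\<dots> = (\<integral>z. h z * h z \<partial>P) - 2 * (\<integral>z. h z * k z \<partial>P) + (\<integral>z. k z * k z \<partial>P)"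
    using ihh ihk ikk by simp
  also have "\<dots> \<le> 0"
    using le kk by simp
  finally have "(\<integral>z. (h z - k z)\<^sup>2 \<partial>P) = 0"
    by (intro antisym integral_nonneg_AE) auto
  moreover have "integrable P (\<lambda>z. (h z - k z)\<^sup>2)"
  proof -
    have "integrable P (\<lambda>z. h z * h z - 2 * (h z * k z) + k z * k z)"
      using ihh ihk ikk by simp
    then show ?thesis
      by (simp add: power2_eq_square algebra_simps)
  qed
  ultimately have "AE z in P. (h z - k z)\<^sup>2 = 0"
    by (subst (asm) integral_nonneg_eq_0_iff_AE) auto
  then show ?thesis
    by eventually_elim (simp add: k_def)
qed

lemma distr_\<Theta>_fst: "distr \<Theta> M fst = M" and distr_\<Theta>_snd: "distr \<Theta> M snd = M"
  using plan by (simp_all add: plan_density_def \<Theta>_def)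

text \<open>Symmetry allows the reflected pair to be removed too: it again has law \<Theta> and so
  is dominated by the plan.\<close>

lemma distr_\<Theta>_swap: "distr \<Theta> P (\<lambda>z. (snd z, fst z)) = \<Theta>"
proof -
  have "\<Theta> = density P (\<lambda>z. ennreal (h (snd z, fst z)))"
    unfolding \<Theta>_def using h_symmetric by (intro density_cong) auto
  then have "distr \<Theta> P (\<lambda>z. (snd z, fst z)) =
      distr (density P (\<lambda>z. ennreal (h (snd z, fst z)))) P (\<lambda>z. (snd z, fst z))"
    by simp
  also have "\<dots> = density (distr P P (\<lambda>z. (snd z, fst z))) (\<lambda>z. ennreal (h z))"
    by (subst density_distr) auto
  also have "distr P P (\<lambda>z. (snd z, fst z)) = P"
    using PP.distr_pair_swap unfolding case_prod_unfold by (rule sym)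
  finally show ?thesis
    by (simp add: \<Theta>_def)
qed

text \<open>\<open>z = (a, b)\<close> is a transported pair into which \<open>x\<close> can be
  inserted: \<open>x\<close> takes the partner \<open>b\<close>, and \<open>a\<close> takes the
  partner \<open>x\<close>. The conjuncts control, in order, the length of the first new pair, its
  regularization, the regularization of the second new pair, and the length of the old pair.\<close>

definition near_pair :: "real \<Rightarrow> 'a \<Rightarrow> 'a \<times> 'a \<Rightarrow> bool" where
  "near_pair R x z \<longleftrightarrow> norm (s x - s (snd z)) \<le> \<delta> \<and> \<epsilon> * h (x, snd z) \<le> \<delta>\<^sup>2 \<and>
     h (fst z, x) \<le> h z \<and> norm (s (fst z) - s (snd z)) \<le> R"

text \<open>Both \<open>h (x, \<cdot>)\<close> and the columns of \<open>h\<close> have mass one, so \<open>h (x, \<cdot>)\<close> cannot be large on the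
  whole ball around \<open>x\<close>, and no column can lie strictly below the column of \<open>x\<close>.\<close>
lemma near_pair_not_null:
  assumes R: "AE z in \<Theta>. norm (s (fst z) - s (snd z)) \<le> R"
  shows "AE x in M. \<not> (AE z in \<Theta>. \<not> near_pair R x z)"
proof -
  have sec1: "AE x in M. (\<integral>\<^sup>+y. ennreal (h (x, y)) \<partial>M) = 1"
    by (rule PP.plan_density_section_fst[OF plan])
  have sec2: "AE y in M. (\<integral>\<^sup>+x. ennreal (h (x, y)) \<partial>M) = 1"
    using PP.plan_density_section_fst[OF plan_density_swap[OF _ _ plan]] sigma_finite_measure_axioms by simp
  show ?thesis
    using sec1 sec2 mass AE_space
  proof eventually_elim
    case (elim x)
    note [measurable] = \<open>x \<in> space M\<close>
    show ?case
    proof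
      assume "AE z in \<Theta>. \<not> near_pair R x z"
      with R have "AE z in \<Theta>. \<not> near_pair R x z \<and> norm (s (fst z) - s (snd z)) \<le> R"
        by eventually_elim simp
      \<comment> \<open>Read against \<open>P\<close>, the assumption says: wherever mass is sent to
        a point \<open>b\<close> that is close to \<open>x\<close> and has small
        \<open>h (x, b)\<close>, the column of \<open>x\<close> is strictly higher than the column
        of \<open>b\<close>.\<close>
      then have "AE z in P. 0 < h z \<longrightarrow> norm (s x - s (snd z)) \<le> \<delta> \<longrightarrow>
          \<epsilon> * h (x, snd z) \<le> \<delta>\<^sup>2 \<longrightarrow> h z < h (fst z, x)"
        unfolding \<Theta>_def by (subst (asm) AE_density) (auto simp: near_pair_def elim!: eventually_mono)
      then have "AE a in M. AE b in M. 0 < h (a, b) \<longrightarrow> norm (s x - s b) \<le> \<delta> \<longrightarrow>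
          \<epsilon> * h (x, b) \<le> \<delta>\<^sup>2 \<longrightarrow> h (a, b) < h (a, x)"
        by (auto dest: PP.AE_pair)
      then have "AE b in M. AE a in M. 0 < h (a, b) \<longrightarrow> norm (s x - s b) \<le> \<delta> \<longrightarrow>
          \<epsilon> * h (x, b) \<le> \<delta>\<^sup>2 \<longrightarrow> h (a, b) < h (a, x)"
        by (subst (asm) PP.AE_commute) measurable
      with sec2 AE_space have large: "AE b in M. norm (s x - s b) \<le> \<delta> \<longrightarrow> \<delta>\<^sup>2 < \<epsilon> * h (x, b)"
      proof eventually_elim
        case (elim b)
        note [measurable] = \<open>b \<in> space M\<close>
        show ?case
        proof (intro impI, rule ccontr)
          assume "norm (s x - s b) \<le> \<delta>" "\<not> \<delta>\<^sup>2 < \<epsilon> * h (x, b)"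
          \<comment> \<open>\<open>h (a, x) - h (a, b)\<close> is nonnegative with integral
            \<open>1 - 1\<close>, so the two columns coincide almost everywhere; strictness then
            leaves no place where the column of \<open>b\<close> is positive, although its mass is
            one.\<close>
          with elim have less: "AE a in M. 0 < h (a, b) \<longrightarrow> h (a, b) < h (a, x)"
            by simp
          have "(\<integral>\<^sup>+a. ennreal (h (a, x)) - ennreal (h (a, b)) \<partial>M) =
              (\<integral>\<^sup>+a. ennreal (h (a, x)) \<partial>M) - (\<integral>\<^sup>+a. ennreal (h (a, b)) \<partial>M)"
          proof (rule nn_integral_diff)
            show "AE a in M. ennreal (h (a, b)) \<le> ennreal (h (a, x))"
              using less
            proof eventually_elim
              case (elim a)
              then show ?case
                using h_nonneg[of "(a, b)"] h_nonneg[of "(a, x)"]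
                by (cases "h (a, b) = 0") (auto intro!: ennreal_leI)
            qed
          qed (use elim in auto)
          also have "\<dots> = 0"
            using elim \<open>(\<integral>\<^sup>+a. ennreal (h (a, x)) \<partial>M) = 1\<close> by simp
          finally have "AE a in M. ennreal (h (a, x)) - ennreal (h (a, b)) = 0"
            by (subst (asm) nn_integral_0_iff_AE) auto
          with less have "AE a in M. ennreal (h (a, b)) = 0"
          proof eventually_elim
            case (elim a)
            then have "h (a, x) \<le> h (a, b)"
              by (metis diff_eq_0_iff_ennreal ennreal_le_iff ennreal_less_top h_nonneg)
            with elim show ?case
              using h_nonneg[of "(a, b)"] by (cases "h (a, b) = 0") auto
          qed
          then have "(\<integral>\<^sup>+a. ennreal (h (a, b)) \<partial>M) = 0"
            by (subst nn_integral_0_iff_AE) auto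
          with elim show False by simp
        qed
      qed
      define B where "B = {y\<in>space M. norm (s x - s y) \<le> \<delta>}"
      have [measurable]: "B \<in> sets M"
        unfolding B_def by measurable
      have int: "integrable M (\<lambda>b. h (x, b))" "(\<integral>b. h (x, b) \<partial>M) = 1"
        using elim(1) h_nonneg
        by (auto intro!: integrableI_nonneg simp: integral_eq_nn_integral)
      have intB: "integrable M (\<lambda>b. h (x, b) * indicator B b)"
        by (rule Bochner_Integration.integrable_bound[OF int(1)]) (auto simp: indicator_def)
      have "(\<integral>b. h (x, b) * indicator B b \<partial>M) \<le> (\<integral>b. h (x, b) \<partial>M)"
        using h_nonneg by (intro integral_mono intB int) (auto simp: indicator_def)
      \<comment> \<open>By \<open>mass\<close>, the integral of \<epsilon> h (x, b) - \<delta>^2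
        over \<open>B\<close> is at most zero, yet \<open>large\<close> makes the integrand positive
        there. So \<open>B\<close> is null, and \<open>mass\<close> would give \<epsilon> \<le>
        0.\<close>
      then have "(\<integral>b. \<epsilon> * (h (x, b) * indicator B b) - \<delta>\<^sup>2 * indicator B b \<partial>M) \<le> \<epsilon> - \<delta>\<^sup>2 * measure M B"
        using intB eps int by (simp add: emeasure_eq_measure)
      also have "\<dots> \<le> 0"
        using elim(3) by (simp add: B_def)
      finally have le: "(\<integral>b. \<epsilon> * (h (x, b) * indicator B b) - \<delta>\<^sup>2 * indicator B b \<partial>M) \<le> 0" .
      have nonneg: "AE b in M. 0 \<le> \<epsilon> * (h (x, b) * indicator B b) - \<delta>\<^sup>2 * indicator B b"
        using large by eventually_elim (auto simp: B_def indicator_def)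
      have "AE b in M. \<epsilon> * (h (x, b) * indicator B b) - \<delta>\<^sup>2 * indicator B b = 0"
      proof (subst integral_nonneg_eq_0_iff_AE[symmetric])
        show "(\<integral>b. \<epsilon> * (h (x, b) * indicator B b) - \<delta>\<^sup>2 * indicator B b \<partial>M) = 0"
          using le integral_nonneg_AE[OF nonneg] by simp
      qed (use intB nonneg in \<open>auto simp: emeasure_eq_measure\<close>)
      with large have "AE b in M. b \<notin> B"
        by eventually_elim (auto simp: B_def indicator_def)
      then have "measure M B = 0"
        by (subst (asm) AE_iff_measurable[of B]) (auto simp: B_def measure_def)
      with elim(3) eps show False
        by (simp add: B_def)
    qed
  qed
qed

text \<open>If \<open>s b\<close> equalled \<open>s x\<close>, the transport cost would not change
  at all. Expanding the squares leaves the square of \<open>norm v\<close> minus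
  \<open>u \<bullet> v\<close>, at most \<delta>^2 + \<delta> R; the other \<delta>^2 is the
  regularization of the new pair \<open>(x, b)\<close>.\<close>

lemma near_pair_gain:
  assumes "near_pair R x z"
  shows "G (x, snd z) + G (fst z, x) - G z \<le> 2 * \<delta>\<^sup>2 + \<delta> * R"
proof -
  define u where "u = s (fst z) - s (snd z)"
  define v where "v = s x - s (snd z)"
  have n: "norm v \<le> \<delta>" "\<epsilon> * h (x, snd z) \<le> \<delta>\<^sup>2" "h (fst z, x) \<le> h z" "norm u \<le> R"
    using assms by (auto simp: near_pair_def u_def v_def)
  have uv: "s (fst z) - s x = u - v"
    by (simp add: u_def v_def)
  have "(norm v)\<^sup>2 / 2 + (norm (u - v))\<^sup>2 / 2 - (norm u)\<^sup>2 / 2 = (norm v)\<^sup>2 - u \<bullet> v"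
    by (simp add: power2_norm_eq_inner inner_simps inner_commute field_simps)
  also have "\<dots> \<le> \<delta>\<^sup>2 + \<delta> * R"
  proof -
    have "(norm v)\<^sup>2 \<le> \<delta>\<^sup>2"
      using n by (intro power_mono) auto
    moreover have "- (u \<bullet> v) \<le> norm v * norm u"
      using norm_cauchy_schwarz[of "- u" v] by (simp add: mult.commute)
    moreover have "norm v * norm u \<le> \<delta> * R"
      using n delta by (intro mult_mono) auto
    ultimately show ?thesis by linarith
  qed
  finally have "(norm v)\<^sup>2 / 2 + (norm (u - v))\<^sup>2 / 2 - (norm u)\<^sup>2 / 2 \<le> \<delta>\<^sup>2 + \<delta> * R" .
  moreover have "\<epsilon> * h (fst z, x) \<le> \<epsilon> * h z"
    using n eps by simp
  ultimately show ?thesis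
    using n(2) unfolding G_def fst_conv snd_conv uv u_def[symmetric] v_def[symmetric] by linarith
qed

text \<open>Two insertions cost at most 4 \<delta>^2 + 2 \<delta> R, and removing a pair and its
  reflection saves at least the square of its length, so a longer pair would permit a profitable
  exchange. Three independent samples of \<Theta> supply the random cycle.\<close>

lemma support_contracts:
  assumes R: "AE z in \<Theta>. norm (s (fst z) - s (snd z)) \<le> R"
  shows "AE z in \<Theta>. (norm (s (fst z) - s (snd z)))\<^sup>2 \<le> 4 * \<delta>\<^sup>2 + 2 * \<delta> * R"
proof -
  interpret \<Theta>: prob_space \<Theta> by (rule prob_space_\<Theta>)
  interpret \<Theta>2: pair_prob_space \<Theta> \<Theta> by unfold_locales
  have prob2: "prob_space (\<Theta> \<Otimes>\<^sub>M \<Theta>)"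
    by (intro prob_space_pair prob_space_\<Theta>)
  interpret \<Theta>3: pair_prob_space \<Theta> "\<Theta> \<Otimes>\<^sub>M \<Theta>" by unfold_locales
  let ?T = "\<Theta> \<Otimes>\<^sub>M (\<Theta> \<Otimes>\<^sub>M \<Theta>)"
  define bad where "bad z \<longleftrightarrow> 4 * \<delta>\<^sup>2 + 2 * \<delta> * R < (norm (s (fst z) - s (snd z)))\<^sup>2" for z
  define E where "E w \<longleftrightarrow> bad (fst w) \<and> near_pair R (fst (fst w)) (fst (snd w)) \<and>
    near_pair R (snd (fst w)) (snd (snd w))" for w
  have [measurable]: "Measurable.pred ?T E"
    unfolding E_def bad_def near_pair_def by measurable
  \<comment> \<open>Restriction to the profitable cycles, without normalization: the laws of all
    pairs can only shrink, and domination is all that the exchange asks for.\<close>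
  define \<Gamma> where "\<Gamma> = density ?T (\<lambda>w. indicator {w. E w} w)"
  have sets_\<Gamma>[measurable_cong]: "sets \<Gamma> = sets ?T"
    by (simp add: \<Gamma>_def)
  have dom: "emeasure (distr \<Gamma> P X) B \<le> emeasure (distr ?T P X) B"
    if [measurable]: "X \<in> ?T \<rightarrow>\<^sub>M P" "B \<in> sets P" for X B
  proof -
    have "emeasure (distr \<Gamma> P X) B = (\<integral>\<^sup>+w. indicator {w. E w} w * indicator (X -` B \<inter> space ?T) w \<partial>?T)"
      unfolding \<Gamma>_def by (subst emeasure_distr) (auto simp: emeasure_density)
    also have "\<dots> \<le> (\<integral>\<^sup>+w. indicator (X -` B \<inter> space ?T) w \<partial>?T)"
      by (intro nn_integral_mono) (auto simp: indicator_def)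
    also have "\<dots> = emeasure (distr ?T P X) B"
      by (simp add: emeasure_distr)
    finally show ?thesis .
  qed
  have fin: "finite_measure \<Gamma>"
  proof
    have "emeasure \<Gamma> (space \<Gamma>) = (\<integral>\<^sup>+w. indicator {w. E w} w * indicator (space ?T) w \<partial>?T)"
      unfolding \<Gamma>_def by (subst emeasure_density) auto
    also have "\<dots> \<le> (\<integral>\<^sup>+w. 1 \<partial>?T)"
      by (intro nn_integral_mono) (auto simp: indicator_def)
    finally have "emeasure \<Gamma> (space \<Gamma>) \<le> (\<integral>\<^sup>+w. 1 \<partial>?T)" .
    then show "emeasure \<Gamma> (space \<Gamma>) \<noteq> \<infinity>"
      using \<Theta>3.emeasure_space_1 by (auto simp: top_unique)
  qed
  interpret \<Gamma>: finite_measure \<Gamma> by (rule fin)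
  have d1: "distr ?T P fst = \<Theta>"
    using prob_space.distr_pair_fst[OF prob2, of \<Theta>] by (simp cong: distr_cong add: sets_\<Theta>)
  have d2: "distr ?T (\<Theta> \<Otimes>\<^sub>M \<Theta>) snd = \<Theta> \<Otimes>\<^sub>M \<Theta>"
    by (intro distr_pair_snd prob_space_\<Theta> prob2 prob_space_imp_sigma_finite)
  have d2f: "distr (\<Theta> \<Otimes>\<^sub>M \<Theta>) P fst = \<Theta>"
    using \<Theta>.distr_pair_fst[of \<Theta>] by (simp cong: distr_cong add: sets_\<Theta>)
  have d2s: "distr (\<Theta> \<Otimes>\<^sub>M \<Theta>) P snd = \<Theta>"
    using distr_pair_snd[OF prob_space_\<Theta> \<Theta>.sigma_finite_measure_axioms]
    by (simp cong: distr_cong add: sets_\<Theta>)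
  have d3f: "distr ?T P (\<lambda>w. fst (snd w)) = \<Theta>"
    using distr_distr[of fst "\<Theta> \<Otimes>\<^sub>M \<Theta>" P snd ?T] unfolding d2 d2f by (simp add: comp_def)
  have d3s: "distr ?T P (\<lambda>w. snd (snd w)) = \<Theta>"
    using distr_distr[of snd "\<Theta> \<Otimes>\<^sub>M \<Theta>" P snd ?T] unfolding d2 d2s by (simp add: comp_def)
  have ds: "distr ?T P (\<lambda>w. (snd (fst w), fst (fst w))) = \<Theta>"
    using distr_distr[of "\<lambda>z. (snd z, fst z)" P P fst ?T] unfolding d1 distr_\<Theta>_swap by (simp add: comp_def)
  have coord: "distr (\<Theta> \<Otimes>\<^sub>M \<Theta>) M (\<lambda>v. f (g v)) = M"
    if "distr \<Theta> M f = M" "distr (\<Theta> \<Otimes>\<^sub>M \<Theta>) P g = \<Theta>" "f \<in> P \<rightarrow>\<^sub>M M" "g \<in> \<Theta> \<Otimes>\<^sub>M \<Theta> \<rightarrow>\<^sub>M P" for f g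
    using distr_distr[of f P M g "\<Theta> \<Otimes>\<^sub>M \<Theta>"] that by (simp add: comp_def)
  have indep: "distr ?T P (\<lambda>w. (f (fst w), g (snd w))) = P"
    if "distr \<Theta> M f = M" "distr (\<Theta> \<Otimes>\<^sub>M \<Theta>) M g = M" "f \<in> \<Theta> \<rightarrow>\<^sub>M M" "g \<in> \<Theta> \<Otimes>\<^sub>M \<Theta> \<rightarrow>\<^sub>M M" for f g
    using that by (intro distr_pair_independent prob_space_\<Theta> prob2)
  have indep': "distr ?T P (\<lambda>w. (g (snd w), f (fst w))) = P"
    if [measurable]: "f \<in> \<Theta> \<rightarrow>\<^sub>M M" "g \<in> \<Theta> \<Otimes>\<^sub>M \<Theta> \<rightarrow>\<^sub>M M"
      and fg: "distr \<Theta> M f = M" "distr (\<Theta> \<Otimes>\<^sub>M \<Theta>) M g = M" for f g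
  proof -
    have "distr ?T P (\<lambda>w. (g (snd w), f (fst w))) =
        distr (distr ?T P (\<lambda>w. (f (fst w), g (snd w)))) P (\<lambda>(x, y). (y, x))"
      by (subst distr_distr) (auto simp: comp_def)
    then show ?thesis
      unfolding indep[OF fg that(1,2)] PP.distr_pair_swap[symmetric] .
  qed
  define I where "I = {0, 1, 2, 3 :: nat}"
  have I: "i = 0 \<or> i = 1 \<or> i = 2 \<or> i = 3" if "i \<in> I" for i
    using that by (auto simp: I_def)
  \<comment> \<open>For \<open>w = ((x, y), (a, b), (a', b'))\<close>, \<open>p\<close> lists the
    pairs removed and \<open>q\<close> the pairs added. Every \<open>p i\<close> has law \<Theta>,
    with \<open>i = 1\<close> relying on the symmetry of \<open>h\<close>. The two coordinates of
    each \<open>q i\<close> come from different samples, which gives the law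
    \<open>P\<close>.\<close>
  define p :: "nat \<Rightarrow> ('a \<times> 'a) \<times> (('a \<times> 'a) \<times> ('a \<times> 'a)) \<Rightarrow> 'a \<times> 'a" where
    "p i w = (if i = 0 then fst w else if i = 1 then (snd (fst w), fst (fst w))
       else if i = 2 then fst (snd w) else snd (snd w))" for i w
  define q :: "nat \<Rightarrow> ('a \<times> 'a) \<times> (('a \<times> 'a) \<times> ('a \<times> 'a)) \<Rightarrow> 'a \<times> 'a" where
    "q i w = (if i = 0 then (fst (fst w), snd (fst (snd w)))
       else if i = 1 then (fst (fst (snd w)), fst (fst w))
       else if i = 2 then (snd (fst w), snd (snd (snd w)))
       else (fst (snd (snd w)), snd (fst w)))" for i w
  have pm: "p i \<in> ?T \<rightarrow>\<^sub>M P" for i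
    unfolding p_def by measurable
  have qm: "q i \<in> ?T \<rightarrow>\<^sub>M P" for i
    unfolding q_def by measurable
  have plaw: "distr ?T P (p i) = \<Theta>" for i
    using d1 d3f d3s ds
    by (cases "i = 0"; cases "i = 1"; cases "i = 2") (simp_all add: p_def[abs_def])
  have qlaw: "distr ?T P (q i) = P" for i
  proof -
    note c = coord[OF distr_\<Theta>_fst d2f] coord[OF distr_\<Theta>_snd d2f] coord[OF distr_\<Theta>_fst d2s] coord[OF distr_\<Theta>_snd d2s]
    have "distr ?T P (\<lambda>w. (fst (fst w), snd (fst (snd w)))) = P"
      by (rule indep[OF distr_\<Theta>_fst c(2)]) measurable
    moreover have "distr ?T P (\<lambda>w. (fst (fst (snd w)), fst (fst w))) = P"
      by (rule indep'[OF _ _ distr_\<Theta>_fst c(1)]) measurable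
    moreover have "distr ?T P (\<lambda>w. (snd (fst w), snd (snd (snd w)))) = P"
      by (rule indep[OF distr_\<Theta>_snd c(4)]) measurable
    moreover have "distr ?T P (\<lambda>w. (fst (snd (snd w)), snd (fst w))) = P"
      by (rule indep'[OF _ _ distr_\<Theta>_snd c(3)]) measurable
    ultimately show ?thesis
      by (cases "i = 0"; cases "i = 1"; cases "i = 2") (simp_all add: q_def[abs_def])
  qed
  have pm': "p i \<in> \<Gamma> \<rightarrow>\<^sub>M P" and qm': "q i \<in> \<Gamma> \<rightarrow>\<^sub>M P" for i
    using pm qm by (simp_all add: measurable_cong_sets[OF sets_\<Gamma> refl])
  have pdom: "emeasure (distr \<Gamma> P (p i)) B \<le> emeasure (density P (\<lambda>z. ennreal (h z))) B" if "B \<in> sets P" for i B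
    using dom[OF pm that, of i] unfolding plaw \<Theta>_def[symmetric] .
  have qdom: "emeasure (distr \<Gamma> P (q i)) B \<le> emeasure P B" if "B \<in> sets P" for i B
    using dom[OF qm that, of i] unfolding qlaw .
  have pq_fst: "(\<Sum>i\<in>I. g (fst (p i w)) :: real) = (\<Sum>i\<in>I. g (fst (q i w)))" for g w
    by (simp add: I_def p_def q_def)
  have pq_snd: "(\<Sum>i\<in>I. g (snd (p i w)) :: real) = (\<Sum>i\<in>I. g (snd (q i w)))" for g w
    by (simp add: I_def p_def q_def)
  have "finite I" "I \<noteq> {}"
    by (auto simp: I_def)
  note exch = PP.plan_density_exchange[OF plan G_meas G_square opt_G this pm' qm' fin pdom qdom pq_fst pq_snd]
  define F where "F w = (\<Sum>i\<in>I. G (p i w)) - (\<Sum>i\<in>I. G (q i w))" for w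
  have Fpos: "0 < F w" if "E w" for w
  proof -
    have 1: "G (fst (fst w), snd (fst (snd w))) + G (fst (fst (snd w)), fst (fst w)) - G (fst (snd w)) \<le> 2 * \<delta>\<^sup>2 + \<delta> * R"
      "G (snd (fst w), snd (snd (snd w))) + G (fst (snd (snd w)), snd (fst w)) - G (snd (snd w)) \<le> 2 * \<delta>\<^sup>2 + \<delta> * R"
      using that near_pair_gain by (auto simp: E_def)
    have "(norm (s (fst (fst w)) - s (snd (fst w))))\<^sup>2 / 2 \<le> G (fst w)"
      "(norm (s (fst (fst w)) - s (snd (fst w))))\<^sup>2 / 2 \<le> G (snd (fst w), fst (fst w))"
      using eps h_nonneg by (auto simp: G_def norm_minus_commute)
    with 1 show ?thesis
      using that unfolding F_def I_def E_def bad_def by (simp add: p_def q_def)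
  qed
  have Fint: "integrable \<Gamma> F"
    unfolding F_def[abs_def]
    by (intro Bochner_Integration.integrable_diff Bochner_Integration.integrable_sum exch(1,2))
  have AEE: "AE w in \<Gamma>. E w"
    unfolding \<Gamma>_def by (subst AE_density) (auto simp: indicator_def)
  then have nonneg: "AE w in \<Gamma>. 0 \<le> F w"
    by eventually_elim (use Fpos in \<open>auto intro: less_imp_le\<close>)
  have "(\<integral>w. (\<Sum>i\<in>I. G (p i w)) \<partial>\<Gamma>) = (\<Sum>i\<in>I. \<integral>w. G (p i w) \<partial>\<Gamma>)"
    by (rule Bochner_Integration.integral_sum) (rule exch(1))
  moreover have "(\<integral>w. (\<Sum>i\<in>I. G (q i w)) \<partial>\<Gamma>) = (\<Sum>i\<in>I. \<integral>w. G (q i w) \<partial>\<Gamma>)"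
    by (rule Bochner_Integration.integral_sum) (rule exch(2))
  moreover have "(\<integral>w. F w \<partial>\<Gamma>) = (\<integral>w. (\<Sum>i\<in>I. G (p i w)) \<partial>\<Gamma>) - (\<integral>w. (\<Sum>i\<in>I. G (q i w)) \<partial>\<Gamma>)"
    unfolding F_def
    by (rule Bochner_Integration.integral_diff; intro Bochner_Integration.integrable_sum exch(1,2))
  ultimately have "(\<integral>w. F w \<partial>\<Gamma>) = (\<Sum>i\<in>I. \<integral>w. G (p i w) \<partial>\<Gamma>) - (\<Sum>i\<in>I. \<integral>w. G (q i w) \<partial>\<Gamma>)"
    by simp
  \<comment> \<open>Optimality bounds the integral of \<open>F\<close> from above by zero, while
    \<open>F\<close> is positive almost everywhere for \<Gamma>; hence \<Gamma> vanishes and the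
    profitable cycles form a null set.\<close>
  with exch(3) integral_nonneg_AE[OF nonneg] have "(\<integral>w. F w \<partial>\<Gamma>) = 0"
    by linarith
  then have "AE w in \<Gamma>. F w = 0"
    using integral_nonneg_eq_0_iff_AE[OF Fint nonneg] by simp
  with AEE have "AE w in \<Gamma>. False"
    by eventually_elim (use Fpos in force)
  then have "AE w in ?T. \<not> E w"
    unfolding \<Gamma>_def by (subst (asm) AE_density) (auto simp: indicator_def)
  \<comment> \<open>Fubini separates the samples. For almost every \<open>z\<close>, near pairs of
    either coordinate have positive probability, so by independence they occur together with
    positive probability; this is incompatible with a bad \<open>z\<close>.\<close>
  then have "AE z in \<Theta>. AE v in \<Theta> \<Otimes>\<^sub>M \<Theta>. \<not> E (z, v)"
    by (rule \<Theta>3.AE_pair)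
  moreover have "AE z in \<Theta>. \<not> (AE z' in \<Theta>. \<not> near_pair R (fst z) z') \<and> \<not> (AE z' in \<Theta>. \<not> near_pair R (snd z) z')"
  proof -
    let ?N = "\<lambda>x. \<not> (AE z in \<Theta>. \<not> near_pair R x z)"
    have "AE x in distr \<Theta> M fst. ?N x" "AE x in distr \<Theta> M snd. ?N x"
      unfolding distr_\<Theta>_fst distr_\<Theta>_snd by (rule near_pair_not_null[OF R])+
    then have "AE z in \<Theta>. ?N (fst z)" "AE z in \<Theta>. ?N (snd z)"
      by (auto dest!: AE_distrD[rotated])
    then show ?thesis
      by eventually_elim simp
  qed
  ultimately have "AE z in \<Theta>. \<not> bad z"
  proof eventually_elim
    case (elim z)
    show ?case
    proof
      assume bad: "bad z"
      have "AE z1 in \<Theta>. AE z2 in \<Theta>. \<not> E (z, z1, z2)"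
        using elim(1) by (rule \<Theta>2.AE_pair)
      then have "AE z1 in \<Theta>. \<not> near_pair R (fst z) z1"
      proof eventually_elim
        case (elim z1)
        show ?case
        proof
          assume "near_pair R (fst z) z1"
          with elim bad have "AE z2 in \<Theta>. \<not> near_pair R (snd z) z2"
            by (simp add: E_def)
          with \<open>\<not> (AE z' in \<Theta>. \<not> near_pair R (fst z) z') \<and> \<not> (AE z' in \<Theta>. \<not> near_pair R (snd z) z')\<close>
          show False by blast
        qed
      qed
      with elim show False by blast
    qed
  qed
  then show ?thesis
    by eventually_elim (simp add: bad_def)
qed

text \<open>For R \<ge> 8 \<delta> one has 4 \<delta>^2 + 2 \<delta> R \<le> (1/16 + 1/4) R^2, which
  is below (3/4 R)^2. Each application therefore shrinks the bound by 3/4 until it meets 8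
  \<delta>.\<close>

theorem support_near_diagonal: "AE z in \<Theta>. norm (s (fst z) - s (snd z)) \<le> 8 * \<delta>"
proof -
  define L where "L = max K 0"
  have iter: "AE z in \<Theta>. norm (s (fst z) - s (snd z)) \<le> max (8 * \<delta>) ((3 / 4) ^ n * (2 * L))" for n
  proof (induction n)
    case 0
    have "AE z in \<Theta>. norm (s (fst z) - s (snd z)) \<le> 2 * K"
      unfolding \<Theta>_def using dist_bounded by (subst AE_density) (auto elim: eventually_mono)
    then show ?case
      by eventually_elim (auto simp: L_def)
  next
    case (Suc n)
    define R where "R = max (8 * \<delta>) ((3 / 4) ^ n * (2 * L))"
    have R: "8 * \<delta> \<le> R" by (simp add: R_def)
    have bound: "4 * \<delta>\<^sup>2 + 2 * \<delta> * R \<le> (3 / 4 * R)\<^sup>2"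
    proof -
      have "\<delta>\<^sup>2 \<le> (R / 8)\<^sup>2"
        using R delta by (intro power_mono) auto
      then have "\<delta>\<^sup>2 \<le> R\<^sup>2 / 64"
        by (simp add: power_divide)
      moreover have "\<delta> * R \<le> R / 8 * R"
        using R delta by (intro mult_right_mono) auto
      then have "\<delta> * R \<le> R\<^sup>2 / 8"
        by (simp add: power2_eq_square)
      moreover have "(3 / 4 * R)\<^sup>2 = 9 / 16 * R\<^sup>2"
        by (simp add: power_mult_distrib power_divide)
      moreover have "0 \<le> R\<^sup>2"
        by simp
      ultimately show ?thesis
        by linarith
    qed
    have R0: "0 \<le> 3 / 4 * R" using R delta by simp
    have le: "3 / 4 * R \<le> max (8 * \<delta>) ((3 / 4) ^ Suc n * (2 * L))"
      using delta by (auto simp: R_def max_def)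
    have "AE z in \<Theta>. (norm (s (fst z) - s (snd z)))\<^sup>2 \<le> 4 * \<delta>\<^sup>2 + 2 * \<delta> * R"
      using Suc unfolding R_def by (rule support_contracts)
    then show ?case
    proof eventually_elim
      case (elim z)
      have "norm (s (fst z) - s (snd z)) \<le> 3 / 4 * R"
        using order_trans[OF elim bound] R0 by (rule power2_le_imp_le)
      then show ?case
        using le by linarith
    qed
  qed
  \<comment> \<open>The maximum equals 8 \<delta> already at a finite stage, so the bound comes from
    a single \<open>n\<close> and not from a limit.\<close>
  have "(\<lambda>n. (3 / 4 :: real) ^ n * (2 * L)) \<longlonglongrightarrow> 0 * (2 * L)"
    by (intro tendsto_mult tendsto_const LIMSEQ_power_zero) auto
  then have "eventually (\<lambda>n. (3 / 4) ^ n * (2 * L) < 8 * \<delta>) sequentially"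
    using delta by (intro order_tendstoD) auto
  then obtain n where "(3 / 4) ^ n * (2 * L) < 8 * \<delta>"
    by (auto simp: eventually_sequentially)
  with iter[of n] show ?thesis
    by (simp add: max_def)
qed

end

section \<open>Supports, first variation and change of variables\<close>

text \<open>The complement of the support is covered by the null members of a countable
  basis.\<close>

lemma AE_msupport:
  fixes M :: "'a::second_countable_topology measure"
  assumes "sets M = sets borel"
  shows "AE x in M. x \<in> msupport M"
proof -
  obtain B :: "'a set set" where B: "countable B" "topological_basis B"
    using ex_countable_basis by blast
  have "AE x in M. \<forall>b\<in>{b\<in>B. emeasure M b = 0}. x \<notin> b"
  proof (rule AE_ball_countable')
    fix b assume b: "b \<in> {b\<in>B. emeasure M b = 0}"
    then have "b \<in> null_sets M"
      using B(2) assms by (auto simp: null_sets_def topological_basis_open)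
    then show "AE x in M. x \<notin> b"
      by (rule AE_not_in)
  qed (use B in auto)
  then show ?thesis
  proof eventually_elim
    case (elim x)
    show ?case
      unfolding msupport_def
    proof safe
      fix U assume "open U" "x \<in> U"
      then obtain b where b: "b \<in> B" "x \<in> b" "b \<subseteq> U"
        using B(2) by (metis topological_basisE)
      then have "0 < emeasure M b"
        using elim by (auto simp: zero_less_iff_neq_zero)
      also have "\<dots> \<le> emeasure M U"
        using \<open>open U\<close> b assms by (intro emeasure_mono) auto
      finally show "0 < emeasure M U" .
    qed
  qed
qed

text \<open>The passage from almost every point to every support point: the points violating
  \<open>Q\<close> form an open null set, which the support avoids.\<close>

lemma msupport_AE_closed:
  fixes M :: "'a::topological_space measure"
  assumes "sets M = sets borel" "closed {x. Q x}" "AE x in M. Q x" "x \<in> msupport M"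
  shows "Q x"
proof (rule ccontr)
  assume "\<not> Q x"
  moreover have "open (- {x. Q x})"
    using assms(2) by (rule open_Compl)
  ultimately have "0 < emeasure M (- {x. Q x})"
    using assms(4) by (auto simp: msupport_def)
  moreover have "emeasure M (- {x. Q x}) = 0"
    using assms \<open>open (- {x. Q x})\<close> sets_eq_imp_space_eq[OF assms(1)]
    by (subst (asm) AE_iff_measurable[of "- {x. Q x}"]) auto
  ultimately show False by simp
qed

section \<open>Convexity of the set of plans and the first variation\<close>

lemma (in pair_prob_space) plan_density_one: "plan_density M1 M2 (\<lambda>_. 1)"
  by (simp add: plan_density_def density_1 M2.distr_pair_fst
      distr_pair_snd[OF M1.prob_space_axioms M2.sigma_finite_measure_axioms])

lemma (in pair_prob_space) plan_density_mix:
  assumes f: "plan_density M1 M2 f" and g: "plan_density M1 M2 g" and t: "0 \<le> t" "t \<le> 1"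
  shows "plan_density M1 M2 (\<lambda>z. (1 - t) * f z + t * g z)"
proof -
  note [measurable] = plan_density_measurable[OF f] plan_density_measurable[OF g]
  have marg: "(\<integral>z. ((1 - t) * f z + t * g z) * indicator B (X z) \<partial>(M1 \<Otimes>\<^sub>M M2)) = m"
    if [measurable]: "X \<in> M1 \<Otimes>\<^sub>M M2 \<rightarrow>\<^sub>M N" "B \<in> sets N"
      and m: "(\<integral>z. f z * indicator B (X z) \<partial>(M1 \<Otimes>\<^sub>M M2)) = m" "(\<integral>z. g z * indicator B (X z) \<partial>(M1 \<Otimes>\<^sub>M M2)) = m"
    for X N m and B :: "'c set"
  proof -
    have i: "integrable (M1 \<Otimes>\<^sub>M M2) (\<lambda>z. k z * indicator B (X z))" if "plan_density M1 M2 k" for k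
      using plan_density_measurable[OF that]
      by (intro Bochner_Integration.integrable_bound[OF plan_density_integrable[OF that]])
        (auto simp: indicator_def)
    have "(\<integral>z. ((1 - t) * f z + t * g z) * indicator B (X z) \<partial>(M1 \<Otimes>\<^sub>M M2)) =
        (\<integral>z. (1 - t) * (f z * indicator B (X z)) + t * (g z * indicator B (X z)) \<partial>(M1 \<Otimes>\<^sub>M M2))"
      by (simp add: algebra_simps)
    also have "\<dots> = (1 - t) * m + t * m"
      using i[OF f] i[OF g] m by simp
    finally show ?thesis
      by (simp add: algebra_simps)
  qed
  have 1: "(\<integral>z. k z * indicator B (fst z) \<partial>(M1 \<Otimes>\<^sub>M M2)) = measure M1 B"
    if "plan_density M1 M2 k" "B \<in> sets M1" for k B
    using plan_density_integral_fst[OF that(1), of "indicator B"] that(2) by simp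
  have 2: "(\<integral>z. k z * indicator B (snd z) \<partial>(M1 \<Otimes>\<^sub>M M2)) = measure M2 B"
    if "plan_density M1 M2 k" "B \<in> sets M2" for k B
    using plan_density_integral_snd[OF that(1), of "indicator B"] that(2) by simp
  show ?thesis
  proof (rule plan_densityI)
    show "integrable (M1 \<Otimes>\<^sub>M M2) (\<lambda>z. ((1 - t) * f z + t * g z)\<^sup>2)"
      by (intro integrable_square_add integrable_square_cmult plan_density_square f g) measurable
    show "(\<integral>z. ((1 - t) * f z + t * g z) * indicator B (fst z) \<partial>(M1 \<Otimes>\<^sub>M M2)) = measure M1 B"
      if "B \<in> sets M1" for B
      using that 1[OF f that] 1[OF g that] by (rule marg[OF measurable_fst])
    show "(\<integral>z. ((1 - t) * f z + t * g z) * indicator B (snd z) \<partial>(M1 \<Otimes>\<^sub>M M2)) = measure M2 B"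
      if "B \<in> sets M2" for B
      using that 2[OF f that] 2[OF g that] by (rule marg[OF measurable_snd])
  qed (use t in \<open>auto simp: plan_density_nonneg[OF f] plan_density_nonneg[OF g]\<close>)
qed

text \<open>Along the segment from \<open>h\<close> to \<open>h'\<close> the objective is a
  quadratic polynomial in \<open>t\<close>. Its increment divided by \<open>t\<close> is affine, and
  letting \<open>t\<close> decrease to zero leaves the derivative; the 2 from the square cancels the
  denominator of \<open>\<epsilon> / 2\<close>.\<close>

lemma (in pair_prob_space) plan_density_first_variation:
  assumes h: "plan_density M1 M2 h" and h': "plan_density M1 M2 h'"
    and [measurable]: "C \<in> borel_measurable (M1 \<Otimes>\<^sub>M M2)" and C2: "integrable (M1 \<Otimes>\<^sub>M M2) (\<lambda>z. (C z)\<^sup>2)"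
    and min: "\<And>k. plan_density M1 M2 k \<Longrightarrow>
      (\<integral>z. C z * h z \<partial>(M1 \<Otimes>\<^sub>M M2)) + \<epsilon> / 2 * (\<integral>z. (h z)\<^sup>2 \<partial>(M1 \<Otimes>\<^sub>M M2))
      \<le> (\<integral>z. C z * k z \<partial>(M1 \<Otimes>\<^sub>M M2)) + \<epsilon> / 2 * (\<integral>z. (k z)\<^sup>2 \<partial>(M1 \<Otimes>\<^sub>M M2))"
  shows "(\<integral>z. (C z + \<epsilon> * h z) * h z \<partial>(M1 \<Otimes>\<^sub>M M2)) \<le> (\<integral>z. (C z + \<epsilon> * h z) * h' z \<partial>(M1 \<Otimes>\<^sub>M M2))"
proof -
  let ?P = "M1 \<Otimes>\<^sub>M M2"
  note [measurable] = plan_density_measurable[OF h] plan_density_measurable[OF h']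
  note sq = plan_density_square[OF h] plan_density_square[OF h'] C2
  have i: "integrable ?P (\<lambda>z. C z * h z)" "integrable ?P (\<lambda>z. C z * h' z)"
    "integrable ?P (\<lambda>z. h z * h' z)" "integrable ?P (\<lambda>z. h z * h z)" "integrable ?P (\<lambda>z. h' z * h' z)"
    by (rule integrable_mult_of_squares; use sq in simp)+
  define ch ch' hh hh' h2 where "ch = (\<integral>z. C z * h z \<partial>?P)" and "ch' = (\<integral>z. C z * h' z \<partial>?P)"
    and "hh = (\<integral>z. h z * h z \<partial>?P)" and "hh' = (\<integral>z. h z * h' z \<partial>?P)" and "h2 = (\<integral>z. h' z * h' z \<partial>?P)"
  have le: "0 \<le> (ch' - ch + \<epsilon> * (hh' - hh)) + t * (\<epsilon> / 2 * (hh - 2 * hh' + h2))"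
    if t: "0 < t" "t \<le> 1" for t
  proof -
    have "plan_density M1 M2 (\<lambda>z. (1 - t) * h z + t * h' z)"
      using t by (intro plan_density_mix h h') auto
    from min[OF this] have "ch + \<epsilon> / 2 * (\<integral>z. (h z)\<^sup>2 \<partial>?P) \<le>
       (\<integral>z. C z * ((1 - t) * h z + t * h' z) \<partial>?P) + \<epsilon> / 2 * (\<integral>z. ((1 - t) * h z + t * h' z)\<^sup>2 \<partial>?P)"
      by (simp add: ch_def)
    also have "(\<integral>z. C z * ((1 - t) * h z + t * h' z) \<partial>?P) = (\<integral>z. (1 - t) * (C z * h z) + t * (C z * h' z) \<partial>?P)"
      by (simp add: algebra_simps)
    also have "\<dots> = (1 - t) * ch + t * ch'"
      using i by (simp add: ch_def ch'_def)
    also have "(\<integral>z. ((1 - t) * h z + t * h' z)\<^sup>2 \<partial>?P) =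
        (\<integral>z. (1 - t)\<^sup>2 * (h z * h z) + 2 * (1 - t) * t * (h z * h' z) + t\<^sup>2 * (h' z * h' z) \<partial>?P)"
      by (intro Bochner_Integration.integral_cong) (auto simp: power2_eq_square algebra_simps)
    also have "\<dots> = (1 - t)\<^sup>2 * hh + 2 * (1 - t) * t * hh' + t\<^sup>2 * h2"
      using i by (simp add: hh_def hh'_def h2_def)
    also have "(\<integral>z. (h z)\<^sup>2 \<partial>?P) = hh"
      by (simp add: hh_def power2_eq_square)
    finally have "0 \<le> t * ((ch' - ch + \<epsilon> * (hh' - hh)) + t * (\<epsilon> / 2 * (hh - 2 * hh' + h2)))"
      by (simp add: power2_eq_square algebra_simps add_divide_distrib)
    then show ?thesis
      using t by (simp add: zero_le_mult_iff)
  qed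
  have "0 \<le> ch' - ch + \<epsilon> * (hh' - hh)"
  proof (rule tendsto_lowerbound)
    show "((\<lambda>t. (ch' - ch + \<epsilon> * (hh' - hh)) + t * (\<epsilon> / 2 * (hh - 2 * hh' + h2))) \<longlongrightarrow>
        ch' - ch + \<epsilon> * (hh' - hh)) (at_right 0)"
      by (auto intro!: tendsto_eq_intros)
    show "\<forall>\<^sub>F t in at_right 0. 0 \<le> (ch' - ch + \<epsilon> * (hh' - hh)) + t * (\<epsilon> / 2 * (hh - 2 * hh' + h2))"
      by (rule eventually_mono[OF eventually_at_right_real[of 0 1]], simp, rule le, auto)
  qed simp
  moreover have "(\<integral>z. (C z + \<epsilon> * h z) * h z \<partial>?P) = ch + \<epsilon> * hh"
  proof -
    have "(\<integral>z. (C z + \<epsilon> * h z) * h z \<partial>?P) = (\<integral>z. C z * h z + \<epsilon> * (h z * h z) \<partial>?P)"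
      by (simp add: algebra_simps)
    then show ?thesis using i by (simp add: ch_def hh_def)
  qed
  moreover have "(\<integral>z. (C z + \<epsilon> * h z) * h' z \<partial>?P) = ch' + \<epsilon> * hh'"
  proof -
    have "(\<integral>z. (C z + \<epsilon> * h z) * h' z \<partial>?P) = (\<integral>z. C z * h' z + \<epsilon> * (h z * h' z) \<partial>?P)"
      by (simp add: algebra_simps)
    then show ?thesis using i by (simp add: ch'_def hh'_def)
  qed
  ultimately show ?thesis
    by (simp add: algebra_simps)
qed

section \<open>Change of variables and shifts of the cost\<close>

text \<open>The second marginal is known only after applying \<open>T\<close>; undoing
  \<open>T\<close> by \<open>T'\<close> recovers \<open>N'\<close>. Used once with \<open>T\<close>
  and once with \<open>T\<close> and \<open>T'\<close> exchanged, this transfers plans in both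
  directions.\<close>

lemma plan_density_pullback:
  assumes "sigma_finite_measure N" "sigma_finite_measure N'"
    and T[measurable]: "T \<in> N' \<rightarrow>\<^sub>M N" and T'[measurable]: "T' \<in> N \<rightarrow>\<^sub>M N'"
    and law: "distr N' N T = N" and inv: "\<And>x. x \<in> space N' \<Longrightarrow> T' (T x) = x"
    and h: "plan_density M N h"
  shows "plan_density M N' (\<lambda>z. h (fst z, T (snd z)))"
    and "distr (density (M \<Otimes>\<^sub>M N') (\<lambda>z. ennreal (h (fst z, T (snd z))))) (M \<Otimes>\<^sub>M N) (\<lambda>z. (fst z, T (snd z)))
      = density (M \<Otimes>\<^sub>M N) (\<lambda>z. ennreal (h z))"
    and "distr (M \<Otimes>\<^sub>M N') (M \<Otimes>\<^sub>M N) (\<lambda>z. (fst z, T (snd z))) = M \<Otimes>\<^sub>M N"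
    and "distr N N' T' = N'"
proof -
  note [measurable] = plan_density_measurable[OF h]
  let ?F = "\<lambda>z. (fst z, T (snd z))"
  let ?D = "density (M \<Otimes>\<^sub>M N') (\<lambda>z. ennreal (h (?F z)))"
  have sf: "sigma_finite_measure (distr N' N T)"
    using assms(1) by (simp add: law)
  have "distr M M (\<lambda>x. x) \<Otimes>\<^sub>M distr N' N T = distr (M \<Otimes>\<^sub>M N') (M \<Otimes>\<^sub>M N) (\<lambda>(x, y). (x, T y))"
    by (rule pair_measure_distr[OF _ T sf]) simp
  then show P: "distr (M \<Otimes>\<^sub>M N') (M \<Otimes>\<^sub>M N) ?F = M \<Otimes>\<^sub>M N"
    unfolding law distr_id2[OF refl] case_prod_unfold by (rule sym)
  show D: "distr ?D (M \<Otimes>\<^sub>M N) ?F = density (M \<Otimes>\<^sub>M N) (\<lambda>z. ennreal (h z))"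
    using density_distr[of "\<lambda>z. ennreal (h z)" "M \<Otimes>\<^sub>M N" ?F "M \<Otimes>\<^sub>M N'"] by (simp add: P)
  have "distr N N' T' = distr (distr N' N T) N' T'"
    by (simp add: law)
  also have "\<dots> = distr N' N' (\<lambda>x. x)"
    by (subst distr_distr, (simp; fail)+, rule distr_cong) (auto simp: inv)
  finally show T'law: "distr N N' T' = N'"
    by simp
  have fst: "distr ?D M fst = M"
  proof -
    have "M = distr (distr ?D (M \<Otimes>\<^sub>M N) ?F) M fst"
      unfolding D plan_density_fst[OF h] ..
    also have "\<dots> = distr ?D M fst"
      by (subst distr_distr) (auto simp: comp_def)
    finally show ?thesis ..
  qed
  have snd: "distr ?D N' snd = N'"
  proof -
    have "N' = distr (distr (distr ?D (M \<Otimes>\<^sub>M N) ?F) N snd) N' T'"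
      unfolding D plan_density_snd[OF h] T'law ..
    also have "\<dots> = distr ?D N' snd"
      using inv by (subst distr_distr, (simp; fail)+, subst distr_distr, (simp; fail)+)
        (auto intro!: distr_cong simp: space_pair_measure)
    finally show ?thesis ..
  qed
  have "integrable (distr (M \<Otimes>\<^sub>M N') (M \<Otimes>\<^sub>M N) ?F) (\<lambda>z. (h z)\<^sup>2)"
    unfolding P by (rule plan_density_square[OF h])
  then have "integrable (M \<Otimes>\<^sub>M N') (\<lambda>z. (h (?F z))\<^sup>2)"
    by (subst (asm) integrable_distr_eq) auto
  then show "plan_density M N' (\<lambda>z. h (?F z))"
    unfolding plan_density_def using fst snd plan_density_nonneg[OF h] by auto
qed

text \<open>A function of one coordinate integrates to the same value against every plan, because
  the marginals are prescribed. Such terms in the cost do not influence which plan is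
  optimal.\<close>

lemma (in pair_prob_space) plan_density_marginal_shift:
  assumes h: "plan_density M1 M2 h"
    and [measurable]: "G \<in> borel_measurable (M1 \<Otimes>\<^sub>M M2)" and G2: "integrable (M1 \<Otimes>\<^sub>M M2) (\<lambda>z. (G z)\<^sup>2)"
    and [measurable]: "\<alpha> \<in> borel_measurable M1" and \<alpha>: "AE x in M1. \<bar>\<alpha> x\<bar> \<le> Ka"
    and [measurable]: "\<beta> \<in> borel_measurable M2" and \<beta>: "AE x in M2. \<bar>\<beta> x\<bar> \<le> Kb"
  shows "(\<integral>z. (G z + \<alpha> (fst z) + \<beta> (snd z)) * h z \<partial>(M1 \<Otimes>\<^sub>M M2)) =
    (\<integral>z. G z * h z \<partial>(M1 \<Otimes>\<^sub>M M2)) + (\<integral>x. \<alpha> x \<partial>M1) + (\<integral>x. \<beta> x \<partial>M2)"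
proof -
  let ?D = "density (M1 \<Otimes>\<^sub>M M2) (\<lambda>z. ennreal (h z))"
  note [measurable] = plan_density_measurable[OF h]
  interpret D: prob_space ?D
    by (rule plan_density_prob[OF h])
  have "AE z in distr ?D M1 fst. \<bar>\<alpha> z\<bar> \<le> Ka" "AE z in distr ?D M2 snd. \<bar>\<beta> z\<bar> \<le> Kb"
    unfolding plan_density_fst[OF h] plan_density_snd[OF h] by fact+
  then have "AE z in ?D. \<bar>\<alpha> (fst z)\<bar> \<le> Ka" "AE z in ?D. \<bar>\<beta> (snd z)\<bar> \<le> Kb"
    by (auto dest!: AE_distrD[rotated])
  then have "integrable ?D (\<lambda>z. \<alpha> (fst z))" "integrable ?D (\<lambda>z. \<beta> (snd z))"
    by (auto intro!: D.integrable_const_bound)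
  then have i: "integrable (M1 \<Otimes>\<^sub>M M2) (\<lambda>z. h z * \<alpha> (fst z))" "integrable (M1 \<Otimes>\<^sub>M M2) (\<lambda>z. h z * \<beta> (snd z))"
    by (simp_all add: integrable_density plan_density_nonneg[OF h])
  have iG: "integrable (M1 \<Otimes>\<^sub>M M2) (\<lambda>z. G z * h z)"
    by (rule integrable_mult_of_squares) (use G2 plan_density_square[OF h] in auto)
  have "(\<integral>z. (G z + \<alpha> (fst z) + \<beta> (snd z)) * h z \<partial>(M1 \<Otimes>\<^sub>M M2)) =
      (\<integral>z. G z * h z + h z * \<alpha> (fst z) + h z * \<beta> (snd z) \<partial>(M1 \<Otimes>\<^sub>M M2))"
    by (simp add: algebra_simps)
  also have "\<dots> = (\<integral>z. G z * h z \<partial>(M1 \<Otimes>\<^sub>M M2)) + (\<integral>x. \<alpha> x \<partial>M1) + (\<integral>x. \<beta> x \<partial>M2)"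
    using i iG by (simp add: plan_density_integral_fst[OF h] plan_density_integral_snd[OF h])
  finally show ?thesis .
qed

section \<open>The quadratically regularized problem\<close>

lemma qcost_measurable: "(\<lambda>z. qcost (fst z) (snd z)) \<in> borel_measurable (borel \<Otimes>\<^sub>M (borel :: 'a::euclidean_space measure))"
  unfolding qcost_def by measurable

lemma qrot_objective_density:
  fixes \<mu> \<nu> :: "'a::euclidean_space measure"
  assumes "prob_space \<mu>" "prob_space \<nu>" and sets: "sets \<mu> = sets borel" "sets \<nu> = sets borel"
    and eps: "0 < \<epsilon>" and h: "plan_density \<mu> \<nu> h"
    and C2: "integrable (\<mu> \<Otimes>\<^sub>M \<nu>) (\<lambda>z. (qcost (fst z) (snd z))\<^sup>2)"
  shows "admissible_coupling \<mu> \<nu> (density (\<mu> \<Otimes>\<^sub>M \<nu>) (\<lambda>z. ennreal (h z)))"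
    and "qrot_objective \<mu> \<nu> \<epsilon> (density (\<mu> \<Otimes>\<^sub>M \<nu>) (\<lambda>z. ennreal (h z))) =
      ennreal ((\<integral>z. qcost (fst z) (snd z) * h z \<partial>(\<mu> \<Otimes>\<^sub>M \<nu>)) + \<epsilon> / 2 * (\<integral>z. (h z)\<^sup>2 \<partial>(\<mu> \<Otimes>\<^sub>M \<nu>)))"
proof -
  interpret pair_prob_space \<mu> \<nu>
    using assms(1,2) by (simp add: pair_prob_space_def pair_sigma_finite_def prob_space_imp_sigma_finite)
  let ?P = "\<mu> \<Otimes>\<^sub>M \<nu>" and ?D = "density (\<mu> \<Otimes>\<^sub>M \<nu>) (\<lambda>z. ennreal (h z))"
  have setsP: "sets ?P = sets (borel \<Otimes>\<^sub>M borel)"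
    using sets by (rule sets_pair_measure_cong)
  note [measurable] = plan_density_measurable[OF h]
  have cm[measurable]: "(\<lambda>z. qcost (fst z) (snd z)) \<in> borel_measurable ?P"
    using qcost_measurable measurable_cong_sets[OF setsP refl] by blast
  have "distr ?D borel fst = distr ?D \<mu> fst" "distr ?D borel snd = distr ?D \<nu> snd"
    using sets by (auto intro!: distr_cong)
  then show "admissible_coupling \<mu> \<nu> ?D"
    unfolding admissible_coupling_def coupling_def
    using setsP plan_density_fst[OF h] plan_density_snd[OF h]
    by (auto intro!: absolutely_continuousI_density)
  have c0: "0 \<le> qcost x y" for x y :: 'a
    by (simp add: qcost_def)
  have ic: "integrable ?P (\<lambda>z. qcost (fst z) (snd z) * h z)"
    by (rule integrable_mult_of_squares) (use C2 plan_density_square[OF h] in auto)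
  have "(\<integral>\<^sup>+z. ennreal (qcost (fst z) (snd z)) \<partial>?D) = (\<integral>\<^sup>+z. ennreal (h z) * ennreal (qcost (fst z) (snd z)) \<partial>?P)"
    by (rule nn_integral_density) auto
  also have "\<dots> = (\<integral>\<^sup>+z. ennreal (qcost (fst z) (snd z) * h z) \<partial>?P)"
    by (intro nn_integral_cong) (simp add: ennreal_mult c0 plan_density_nonneg[OF h] mult.commute)
  also have "\<dots> = ennreal (\<integral>z. qcost (fst z) (snd z) * h z \<partial>?P)"
    by (rule nn_integral_eq_integral[OF ic]) (simp add: c0 plan_density_nonneg[OF h])
  finally have 1: "(\<integral>\<^sup>+z. ennreal (qcost (fst z) (snd z)) \<partial>?D) = ennreal (\<integral>z. qcost (fst z) (snd z) * h z \<partial>?P)" .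
  have "AE z in ?P. ennreal (h z) = RN_deriv ?P ?D z"
    by (rule RN_deriv_unique) auto
  then have "(\<integral>\<^sup>+z. (RN_deriv ?P ?D z)\<^sup>2 \<partial>?P) = (\<integral>\<^sup>+z. ennreal ((h z)\<^sup>2) \<partial>?P)"
    by (intro nn_integral_cong_AE, eventually_elim)
      (simp add: plan_density_nonneg[OF h] flip: ennreal_power)
  also have "\<dots> = ennreal (\<integral>z. (h z)\<^sup>2 \<partial>?P)"
    by (rule nn_integral_eq_integral[OF plan_density_square[OF h]]) simp
  finally have 2: "(\<integral>\<^sup>+z. (RN_deriv ?P ?D z)\<^sup>2 \<partial>?P) = ennreal (\<integral>z. (h z)\<^sup>2 \<partial>?P)" .
  have n: "0 \<le> (\<integral>z. qcost (fst z) (snd z) * h z \<partial>?P)" "0 \<le> (\<integral>z. (h z)\<^sup>2 \<partial>?P)"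
    by (auto intro!: integral_nonneg_AE simp: c0 plan_density_nonneg[OF h])
  have "ennreal (\<epsilon> / 2 * (\<integral>z. (h z)\<^sup>2 \<partial>?P)) = ennreal (\<epsilon> / 2) * ennreal (\<integral>z. (h z)\<^sup>2 \<partial>?P)"
    using n eps by (intro ennreal_mult) auto
  moreover have "ennreal ((\<integral>z. qcost (fst z) (snd z) * h z \<partial>?P) + \<epsilon> / 2 * (\<integral>z. (h z)\<^sup>2 \<partial>?P)) =
      ennreal (\<integral>z. qcost (fst z) (snd z) * h z \<partial>?P) + ennreal (\<epsilon> / 2 * (\<integral>z. (h z)\<^sup>2 \<partial>?P))"
    using n eps by (intro ennreal_plus) auto
  ultimately show "qrot_objective \<mu> \<nu> \<epsilon> ?D =
      ennreal ((\<integral>z. qcost (fst z) (snd z) * h z \<partial>?P) + \<epsilon> / 2 * (\<integral>z. (h z)\<^sup>2 \<partial>?P))"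
    unfolding qrot_objective_def 1 2 by simp
qed

text \<open>The product coupling has finite objective, hence so does the minimizer. Its
  Radon-Nikodym derivative is therefore square integrable and almost everywhere finite, and a
  real-valued representative \<open>h\<close> exists.\<close>

lemma qrot_minimizer_density:
  fixes \<mu> \<nu> :: "'a::euclidean_space measure"
  assumes prob: "prob_space \<mu>" "prob_space \<nu>" and sets: "sets \<mu> = sets borel" "sets \<nu> = sets borel"
    and eps: "0 < \<epsilon>" and min: "qrot_minimizer \<mu> \<nu> \<epsilon> \<pi>"
    and C2: "integrable (\<mu> \<Otimes>\<^sub>M \<nu>) (\<lambda>z. (qcost (fst z) (snd z))\<^sup>2)"
  obtains h where "plan_density \<mu> \<nu> h" "\<pi> = density (\<mu> \<Otimes>\<^sub>M \<nu>) (\<lambda>z. ennreal (h z))"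
    "\<And>h'. plan_density \<mu> \<nu> h' \<Longrightarrow>
      (\<integral>z. (qcost (fst z) (snd z) + \<epsilon> * h z) * h z \<partial>(\<mu> \<Otimes>\<^sub>M \<nu>))
      \<le> (\<integral>z. (qcost (fst z) (snd z) + \<epsilon> * h z) * h' z \<partial>(\<mu> \<Otimes>\<^sub>M \<nu>))"
proof -
  interpret pair_prob_space \<mu> \<nu>
    using prob by (simp add: pair_prob_space_def pair_sigma_finite_def prob_space_imp_sigma_finite)
  let ?P = "\<mu> \<Otimes>\<^sub>M \<nu>" and ?C = "\<lambda>z::'a \<times> 'a. qcost (fst z) (snd z)"
  have setsP: "sets ?P = sets (borel \<Otimes>\<^sub>M borel)"
    using sets by (rule sets_pair_measure_cong)
  have cm[measurable]: "?C \<in> borel_measurable ?P"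
    using qcost_measurable measurable_cong_sets[OF setsP refl] by blast
  note dens = qrot_objective_density[OF prob sets eps _ C2]
  have adm: "admissible_coupling \<mu> \<nu> \<pi>"
    and le: "\<And>\<pi>'. admissible_coupling \<mu> \<nu> \<pi>' \<Longrightarrow> qrot_objective \<mu> \<nu> \<epsilon> \<pi> \<le> qrot_objective \<mu> \<nu> \<epsilon> \<pi>'"
    using min by (auto simp: qrot_minimizer_def)
  define f where "f = RN_deriv ?P \<pi>"
  have [measurable]: "f \<in> borel_measurable ?P"
    by (simp add: f_def)
  have \<pi>f: "density ?P f = \<pi>"
    unfolding f_def using adm setsP
    by (intro density_RN_deriv) (auto simp: admissible_coupling_def coupling_def)
  have "qrot_objective \<mu> \<nu> \<epsilon> \<pi> < \<infinity>"
    using le[OF dens(1)[OF plan_density_one]] unfolding dens(2)[OF plan_density_one]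
    by (auto simp: le_less_trans)
  then have "ennreal (\<epsilon> / 2) * (\<integral>\<^sup>+z. (f z)\<^sup>2 \<partial>?P) < \<infinity>"
    unfolding qrot_objective_def f_def by (simp add: ennreal_add_eq_top less_top)
  then have fin: "(\<integral>\<^sup>+z. (f z)\<^sup>2 \<partial>?P) < \<infinity>"
    using eps by (auto simp: ennreal_mult_less_top)
  have "AE z in ?P. (f z)\<^sup>2 \<noteq> \<infinity>"
    using fin by (intro nn_integral_noteq_infinite) auto
  then have AEf: "AE z in ?P. f z = ennreal (enn2real (f z))"
    by eventually_elim (auto simp: power2_eq_square ennreal_mult_eq_top_iff less_top)
  define h where "h z = enn2real (f z)" for z
  have [measurable]: "h \<in> borel_measurable ?P"
    unfolding h_def by measurable
  have \<pi>h: "\<pi> = density ?P (\<lambda>z. ennreal (h z))"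
    unfolding \<pi>f[symmetric] h_def using AEf by (intro density_cong) auto
  have "(\<integral>\<^sup>+z. ennreal ((h z)\<^sup>2) \<partial>?P) = (\<integral>\<^sup>+z. (f z)\<^sup>2 \<partial>?P)"
    using AEf by (intro nn_integral_cong_AE, eventually_elim) (simp add: h_def flip: ennreal_power)
  with fin have sq: "integrable ?P (\<lambda>z. (h z)\<^sup>2)"
    by (intro integrableI_nonneg) auto
  have "distr \<pi> borel fst = distr \<pi> \<mu> fst" "distr \<pi> borel snd = distr \<pi> \<nu> snd"
    using sets by (auto intro!: distr_cong)
  then have plan: "plan_density \<mu> \<nu> h"
    unfolding plan_density_def \<pi>h[symmetric] using adm sq
    by (auto simp: admissible_coupling_def coupling_def h_def)
  have J: "(\<integral>z. ?C z * h z \<partial>?P) + \<epsilon> / 2 * (\<integral>z. (h z)\<^sup>2 \<partial>?P)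
      \<le> (\<integral>z. ?C z * k z \<partial>?P) + \<epsilon> / 2 * (\<integral>z. (k z)\<^sup>2 \<partial>?P)" if k: "plan_density \<mu> \<nu> k" for k
  proof -
    have "0 \<le> (\<integral>z. ?C z * k z \<partial>?P) + \<epsilon> / 2 * (\<integral>z. (k z)\<^sup>2 \<partial>?P)"
      using eps by (intro add_nonneg_nonneg mult_nonneg_nonneg integral_nonneg_AE)
        (auto simp: qcost_def plan_density_nonneg[OF k])
    then show ?thesis
      using le[OF dens(1)[OF k]] unfolding \<pi>h dens(2)[OF k] dens(2)[OF plan] by simp
  qed
  show thesis
    by (rule that[OF plan \<pi>h]) (rule plan_density_first_variation[OF plan _ cm C2 J])
qed

text \<open>The part of the ball inside the image is the image of its preimage, so one linear change
  of variables suffices; openness of \<Omega> passes to its image and supplies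
  measurability.\<close>

lemma image_cball_measure:
  fixes S :: "real^'n^'n"
  assumes S: "invertible S" and \<Omega>: "open \<Omega>" "bounded \<Omega>"
  shows "measure lborel ((\<lambda>x. S *v x) ` \<Omega> \<inter> cball u r) =
    \<bar>det S\<bar> * measure lborel (\<Omega> \<inter> {y. norm (u - S *v y) \<le> r})"
proof -
  let ?W = "\<Omega> \<inter> {y. norm (u - S *v y) \<le> r}"
  have "closed {y. norm (u - S *v y) \<le> r}"
    by (intro closed_Collect_le continuous_intros)
  then have W: "?W \<in> sets borel"
    using \<Omega>(1) by auto
  have im: "(*v) S ` ?W = (*v) S ` \<Omega> \<inter> cball u r"
    by (auto simp: dist_norm)
  have "open ((*v) S ` \<Omega>)"
    using S \<Omega>(1) by (intro open_surjective_linear_image) (auto simp: invertible_eq_bij bij_is_surj)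
  then have "(*v) S ` ?W \<in> sets borel"
    unfolding im by auto
  moreover have "bounded ?W"
    using \<Omega>(2) by (rule bounded_subset) auto
  ultimately have "measure lborel ((*v) S ` ?W) = \<bar>det S\<bar> * measure lborel ?W"
    using W by (intro measure_linear_image_cart)
  then show ?thesis
    unfolding im .
qed

lemma density_indicator_lower_bound:
  fixes \<rho> :: "'a::euclidean_space \<Rightarrow> real"
  assumes prob: "prob_space \<mu>" and [measurable]: "\<rho> \<in> borel_measurable lborel" "\<Omega> \<in> sets borel" "W \<in> sets borel"
    and \<mu>: "\<mu> = density lborel (\<lambda>x. ennreal (\<rho> x * indicator \<Omega> x))"
    and lb: "AE x in lborel. x \<in> \<Omega> \<longrightarrow> l \<le> \<rho> x" and l: "0 \<le> l" and "bounded \<Omega>"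
  shows "l * measure lborel (\<Omega> \<inter> W) \<le> measure \<mu> W"
proof -
  interpret prob_space \<mu> by fact
  have fin: "emeasure lborel (\<Omega> \<inter> W) < \<infinity>"
    using \<open>bounded \<Omega>\<close> by (intro emeasure_bounded_finite) (auto intro: bounded_subset)
  have "ennreal (l * measure lborel (\<Omega> \<inter> W)) = ennreal l * emeasure lborel (\<Omega> \<inter> W)"
    using fin l by (simp add: ennreal_mult emeasure_eq_ennreal_measure)
  also have "\<dots> = (\<integral>\<^sup>+x. ennreal l * indicator (\<Omega> \<inter> W) x \<partial>lborel)"
    by (simp add: nn_integral_cmult_indicator)
  also have "\<dots> \<le> (\<integral>\<^sup>+x. ennreal (\<rho> x * indicator \<Omega> x) * indicator W x \<partial>lborel)"
    using lb by (intro nn_integral_mono_AE, eventually_elim) (auto simp: indicator_def ennreal_leI)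
  also have "\<dots> = emeasure \<mu> W"
    unfolding \<mu> by (simp add: emeasure_density)
  finally show ?thesis
    by (simp add: emeasure_eq_measure)
qed

lemma AE_bounded_image:
  fixes f :: "'a::euclidean_space \<Rightarrow> 'b::real_normed_vector"
  assumes "AE x in M. x \<in> cball 0 1" "continuous_on UNIV f"
  obtains K where "AE x in M. norm (f x) \<le> K"
proof -
  have "compact (f ` cball 0 1)"
    using assms(2) by (intro compact_continuous_image compact_cball) (auto intro: continuous_on_subset)
  then obtain K where K: "\<forall>y\<in>f ` cball 0 1. norm y \<le> K"
    using compact_imp_bounded bounded_iff by blast
  have "AE x in M. norm (f x) \<le> K"
    using assms(1) by eventually_elim (use K in auto)
  then show thesis
    by (rule that)
qed

lemma continuous_on_matrix_vector_mult:
  fixes M :: "real^'n^'m"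
  shows "continuous_on X f \<Longrightarrow> continuous_on X (\<lambda>x. M *v f x)"
  by (rule bounded_linear.continuous_on[OF matrix_vector_mul_bounded_linear])

lemma qrot_support_near_affine:
  fixes \<mu> \<nu> :: "(real^'n) measure" and A S :: "real^'n^'n"
  assumes prob: "prob_space \<mu>" and sets: "sets \<mu> = sets borel" "sets \<nu> = sets borel"
    and bdd: "AE x in \<mu>. x \<in> cball 0 1"
    and S: "sym_matrix S" "S ** S = A" and inv: "invertible A"
    and law: "distr \<mu> borel (\<lambda>x. A *v x + a) = \<nu>"
    and min: "qrot_minimizer \<mu> \<nu> \<epsilon> \<pi>" and eps: "0 < \<epsilon>" and delta: "0 < \<delta>"
    and mass: "AE x in \<mu>. \<epsilon> \<le> \<delta>\<^sup>2 * measure \<mu> {y. norm (S *v x - S *v y) \<le> \<delta>}"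
    and z: "z \<in> msupport \<pi>"
  shows "norm (snd z - (A *v fst z + a)) \<le> 8 * sqrt (lambda_max A) * \<delta>"
proof -
  interpret \<mu>: prob_space \<mu> by fact
  define T where "T x = A *v x + a" for x
  obtain R where R: "A ** R = mat 1" "R ** A = mat 1"
    using inv by (auto simp: invertible_def)
  define T' where "T' y = R *v (y - a)" for y
  have T'T: "T' (T x) = x" and TT': "T (T' y) = y" for x y
    by (simp_all add: T_def T'_def matrix_vector_mul_assoc R)
  have Tc: "continuous_on UNIV T" and T'c: "continuous_on UNIV T'"
    unfolding T_def[abs_def] T'_def[abs_def] by (intro continuous_intros continuous_on_matrix_vector_mult)+
  have Tb: "T \<in> borel_measurable borel" and T'b: "T' \<in> borel_measurable borel"
    using Tc T'c by (auto intro: borel_measurable_continuous_onI)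
  note mc = measurable_cong_sets[OF sets(1) refl] measurable_cong_sets[OF sets(2) refl]
  have Tm[measurable]: "T \<in> \<mu> \<rightarrow>\<^sub>M \<nu>" and T'm[measurable]: "T' \<in> \<nu> \<rightarrow>\<^sub>M \<mu>"
    using Tb T'b by (simp_all add: measurable_cong_sets[OF sets] measurable_cong_sets[OF sets(2,1)])
  have Tlaw: "distr \<mu> \<nu> T = \<nu>"
    using law sets by (simp add: T_def[abs_def] cong: distr_cong)
  have prob\<nu>: "prob_space \<nu>"
    using \<mu>.prob_space_distr[OF Tm] by (simp only: Tlaw)
  interpret \<nu>: prob_space \<nu> by fact
  interpret mm: pair_prob_space \<mu> \<mu> by unfold_locales
  interpret mn: pair_prob_space \<mu> \<nu> by unfold_locales
  let ?P = "\<mu> \<Otimes>\<^sub>M \<nu>" and ?Q = "\<mu> \<Otimes>\<^sub>M \<mu>"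
  let ?F = "\<lambda>z. (fst z, T (snd z))"
  let ?C = "\<lambda>z::(real^'n) \<times> (real^'n). qcost (fst z) (snd z)"
  have setsP: "sets ?P = sets (borel \<Otimes>\<^sub>M borel)" and setsQ: "sets ?Q = sets (borel \<Otimes>\<^sub>M borel)"
    using sets by (auto intro!: sets_pair_measure_cong)
  have cm[measurable]: "?C \<in> borel_measurable ?P"
    using qcost_measurable measurable_cong_sets[OF setsP refl] by blast
  obtain K1 where K1: "AE x in \<mu>. norm x \<le> K1"
    using AE_bounded_image[OF bdd continuous_on_id] by blast
  obtain K2 where K2: "AE x in \<mu>. norm (T x) \<le> K2"
    using AE_bounded_image[OF bdd Tc] by blast
  have "AE y in distr \<mu> \<nu> T. norm y \<le> K2"
  proof (subst AE_distr_iff[OF Tm])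
    show "{y \<in> space \<nu>. norm y \<le> K2} \<in> sets \<nu>"
      using sets(2) sets_eq_imp_space_eq[OF sets(2)] by simp
  qed (use K2 in simp)
  then have K2': "AE y in \<nu>. norm y \<le> K2"
    by (simp only: Tlaw)
  have C2: "integrable ?P (\<lambda>z. (?C z)\<^sup>2)"
  proof (rule mn.integrable_const_bound)
    have "AE z in ?P. norm (fst z) \<le> K1 \<and> norm (snd z) \<le> K2"
    proof (rule mn.AE_pair_measure)
      show "{z \<in> space ?P. norm (fst z) \<le> K1 \<and> norm (snd z) \<le> K2} \<in> sets ?P"
        unfolding setsP sets_eq_imp_space_eq[OF setsP] by measurable
      show "AE x in \<mu>. AE y in \<nu>. norm (fst (x, y)) \<le> K1 \<and> norm (snd (x, y)) \<le> K2"
        using K1 by eventually_elim (use K2' in simp)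
    qed
    then show "AE z in ?P. norm ((?C z)\<^sup>2) \<le> ((K1 + K2)\<^sup>2 / 2)\<^sup>2"
    proof eventually_elim
      case (elim z)
      then have "norm (fst z - snd z) \<le> K1 + K2"
        using norm_triangle_ineq4[of "fst z" "snd z"] by linarith
      then have "(norm (fst z - snd z))\<^sup>2 \<le> (K1 + K2)\<^sup>2"
        by (intro power_mono) auto
      then have "(?C z)\<^sup>2 \<le> ((K1 + K2)\<^sup>2 / 2)\<^sup>2"
        unfolding qcost_def by (intro power_mono) auto
      then show ?case
        by (simp only: real_norm_def abs_power2)
    qed
  qed measurable
  obtain h where h: "plan_density \<mu> \<nu> h" and \<pi>: "\<pi> = density ?P (\<lambda>z. ennreal (h z))"
    and opt: "\<And>h'. plan_density \<mu> \<nu> h' \<Longrightarrow>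
      (\<integral>z. (?C z + \<epsilon> * h z) * h z \<partial>?P) \<le> (\<integral>z. (?C z + \<epsilon> * h z) * h' z \<partial>?P)"
    using qrot_minimizer_density[OF prob prob\<nu> sets eps min C2] by blast
  note hm[measurable] = plan_density_measurable[OF h]
  define g where "g z = h (?F z)" for z
  note pull = plan_density_pullback[OF \<nu>.sigma_finite_measure_axioms \<mu>.sigma_finite_measure_axioms Tm T'm Tlaw T'T]
  have g: "plan_density \<mu> \<mu> g"
    unfolding g_def by (rule pull(1)[OF h])
  note gm[measurable] = plan_density_measurable[OF g]
  have Sm[measurable]: "(*v) S \<in> borel_measurable \<mu>"
    unfolding mc by (intro borel_measurable_continuous_onI continuous_intros continuous_on_matrix_vector_mult)
  have SA: "(S *v x) \<bullet> (S *v y) = x \<bullet> (A *v y)" for x y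
    unfolding S(2)[symmetric] matrix_vector_mul_assoc[symmetric] by (rule sym_matrix_selfadjoint[OF S(1)])
  define c where "c z = (norm (S *v fst z - S *v snd z))\<^sup>2 / 2" for z
  \<comment> \<open>The one-variable parts of the cost: |x - T x'|^2 / 2 and |S x - S x'|^2 / 2
    share the cross term - x \<bullet> A x', and the leftover squares and x \<bullet> a are
    collected in \<alpha> and \<beta>.\<close>
  define \<alpha> where "\<alpha> x = (x \<bullet> x - x \<bullet> (A *v x)) / 2 - x \<bullet> a" for x
  define \<beta> where "\<beta> x = (T x \<bullet> T x - x \<bullet> (A *v x)) / 2" for x
  have \<alpha>c: "continuous_on UNIV \<alpha>" and \<beta>c: "continuous_on UNIV \<beta>"
    unfolding \<alpha>_def[abs_def] \<beta>_def[abs_def]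
    by (auto intro!: continuous_intros continuous_on_matrix_vector_mult Tc)
  have \<alpha>m: "\<alpha> \<in> borel_measurable \<mu>" and \<beta>m: "\<beta> \<in> borel_measurable \<mu>"
    unfolding mc by (intro borel_measurable_continuous_onI \<alpha>c \<beta>c)+
  obtain Ka where Ka: "AE x in \<mu>. norm (\<alpha> x) \<le> Ka"
    by (rule AE_bounded_image[OF bdd \<alpha>c])
  obtain Kb where Kb: "AE x in \<mu>. norm (\<beta> x) \<le> Kb"
    by (rule AE_bounded_image[OF bdd \<beta>c])
  obtain Ks where Ks: "AE x in \<mu>. norm (S *v x) \<le> Ks"
    by (rule AE_bounded_image[OF bdd continuous_on_matrix_vector_mult[OF continuous_on_id]])
  have split: "?C (?F z) = c z + \<alpha> (fst z) + \<beta> (snd z)" for z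
  proof -
    define x y where "x = fst z" and "y = snd z"
    have "(norm (x - T y))\<^sup>2 = x \<bullet> x - 2 * (x \<bullet> T y) + T y \<bullet> T y"
      by (simp add: power2_norm_eq_inner inner_diff_left inner_diff_right inner_commute)
    moreover have "x \<bullet> T y = x \<bullet> (A *v y) + x \<bullet> a"
      by (simp add: T_def inner_add_right)
    moreover have "(norm (S *v x - S *v y))\<^sup>2 = x \<bullet> (A *v x) - 2 * (x \<bullet> (A *v y)) + y \<bullet> (A *v y)"
      unfolding SA[symmetric]
      by (simp add: power2_norm_eq_inner inner_diff_left inner_diff_right inner_commute)
    ultimately show ?thesis
      unfolding qcost_def c_def \<alpha>_def \<beta>_def fst_conv snd_conv x_def[symmetric] y_def[symmetric]
      by (simp add: field_simps)
  qed
  have cm'[measurable]: "c \<in> borel_measurable ?Q"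
    unfolding c_def by measurable
  have c2: "integrable ?Q (\<lambda>z. (c z)\<^sup>2)"
  proof (rule mm.integrable_const_bound)
    have "AE z in ?Q. norm (S *v fst z) \<le> Ks \<and> norm (S *v snd z) \<le> Ks"
    proof (rule mm.AE_pair_measure)
      show "AE x in \<mu>. AE y in \<mu>. norm (S *v fst (x, y)) \<le> Ks \<and> norm (S *v snd (x, y)) \<le> Ks"
        using Ks by eventually_elim (use Ks in simp)
    qed measurable
    then show "AE z in ?Q. norm ((c z)\<^sup>2) \<le> ((Ks + Ks)\<^sup>2 / 2)\<^sup>2"
    proof eventually_elim
      case (elim z)
      then have "norm (S *v fst z - S *v snd z) \<le> Ks + Ks"
        using norm_triangle_ineq4[of "S *v fst z" "S *v snd z"] by linarith
      then have "(norm (S *v fst z - S *v snd z))\<^sup>2 \<le> (Ks + Ks)\<^sup>2"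
        by (intro power_mono) auto
      then have "(c z)\<^sup>2 \<le> ((Ks + Ks)\<^sup>2 / 2)\<^sup>2"
        unfolding c_def by (intro power_mono) auto
      then show ?case
        by (simp only: real_norm_def abs_power2)
    qed
  qed measurable
  define G where "G z = c z + \<epsilon> * g z" for z
  have Gm[measurable]: "G \<in> borel_measurable ?Q"
    unfolding G_def by measurable
  have G2: "integrable ?Q (\<lambda>z. (G z)\<^sup>2)"
    unfolding G_def by (intro integrable_square_add integrable_square_cmult c2 plan_density_square[OF g]) measurable
  have Fm[measurable]: "?F \<in> ?Q \<rightarrow>\<^sub>M ?P"
    by measurable
  have pull_int: "(\<integral>z. (?C z + \<epsilon> * h z) * k z \<partial>?P) =
      (\<integral>z. G z * k (?F z) \<partial>?Q) + (\<integral>x. \<alpha> x \<partial>\<mu>) + (\<integral>x. \<beta> x \<partial>\<mu>)" if k: "plan_density \<mu> \<nu> k" for k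
  proof -
    note [measurable] = plan_density_measurable[OF k]
    have "(\<integral>z. (?C z + \<epsilon> * h z) * k z \<partial>?P) = (\<integral>z. (?C z + \<epsilon> * h z) * k z \<partial>distr ?Q ?P ?F)"
      unfolding pull(3)[OF h] ..
    also have "\<dots> = (\<integral>z. (?C (?F z) + \<epsilon> * h (?F z)) * k (?F z) \<partial>?Q)"
      by (rule integral_distr[OF Fm]) measurable
    also have "\<dots> = (\<integral>z. (G z + \<alpha> (fst z) + \<beta> (snd z)) * k (?F z) \<partial>?Q)"
      unfolding split G_def g_def by (simp add: algebra_simps)
    also have "\<dots> = (\<integral>z. G z * k (?F z) \<partial>?Q) + (\<integral>x. \<alpha> x \<partial>\<mu>) + (\<integral>x. \<beta> x \<partial>\<mu>)"
      using Ka Kb by (intro mm.plan_density_marginal_shift pull(1) k G2 \<alpha>m \<beta>m Gm) auto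
    finally show ?thesis .
  qed
  \<comment> \<open>A competitor \<open>k\<close> for the self-transport is carried by
    \<open>T'\<close> to a coupling of \<mu> and \<nu>, where \<open>opt\<close> applies;
    \<open>pull_int\<close> adds the same constant on both sides.\<close>
  have opt': "(\<integral>z. G z * g z \<partial>?Q) \<le> (\<integral>z. G z * k z \<partial>?Q)" if k: "plan_density \<mu> \<mu> k" for k
  proof -
    define k' where "k' z = k (fst z, T' (snd z))" for z
    have k': "plan_density \<mu> \<nu> k'"
      unfolding k'_def
      by (rule plan_density_pullback(1)[OF \<mu>.sigma_finite_measure_axioms \<nu>.sigma_finite_measure_axioms
            T'm Tm pull(4)[OF h] TT' k])
    have "k' (?F z) = k z" for z
      by (simp add: k'_def T'T)
    then show ?thesis
      using opt[OF k'] unfolding pull_int[OF h] pull_int[OF k'] g_def[symmetric] by simp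
  qed
  have space: "space \<mu> = UNIV"
    using sets_eq_imp_space_eq[OF sets(1)] by simp
  interpret self_transport \<mu> "(*v) S" g \<epsilon> \<delta> Ks
    by unfold_locales
      (use Ks g eps delta opt' mass Sm in \<open>simp_all add: G_def c_def space\<close>)
  have rayleigh: "(norm (S *v w))\<^sup>2 \<le> lambda_max A * (norm w)\<^sup>2" for w
  proof -
    have "sym_matrix A"
      using S by (auto simp: sym_matrix_def matrix_transpose_mul)
    then show ?thesis
      using rayleigh_le_lambda_max[of A w] SA[of w w] by (simp add: power2_norm_eq_inner)
  qed
  have lmax: "0 \<le> lambda_max A"
  proof -
    obtain e :: "real^'n" where "norm e = 1"
      using vector_choose_size[of 1] by auto
    then show ?thesis
      using rayleigh[of e] order_trans[OF zero_le_power2] by fastforce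
  qed
  have AE1: "AE z in \<Theta>. norm (snd (?F z) - T (fst (?F z))) \<le> 8 * sqrt (lambda_max A) * \<delta>"
    using support_near_diagonal
  proof eventually_elim
    case (elim z)
    define v where "v = snd z - fst z"
    define w where "w = S *v v"
    \<comment> \<open>\<open>A\<close> is \<open>S ** S\<close>: one factor is absorbed in the
      estimate near the diagonal, the other costs its operator norm, bounded by
      \<open>sqrt (lambda_max A)\<close>.\<close>
    have "T (snd z) - T (fst z) = S *v w"
      by (simp add: T_def v_def w_def matrix_vector_mult_diff_distrib matrix_vector_mul_assoc S(2))
    moreover have "norm (S *v w) \<le> sqrt (lambda_max A * (norm w)\<^sup>2)"
      by (rule real_le_rsqrt[OF rayleigh])
    moreover have "norm w \<le> 8 * \<delta>"
      using elim by (simp add: w_def v_def matrix_vector_mult_diff_distrib norm_minus_commute)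
    moreover have "0 \<le> sqrt (lambda_max A)"
      using lmax by simp
    ultimately show ?case
      using mult_left_mono[of "norm w" "8 * \<delta>" "sqrt (lambda_max A)"] by (simp add: real_sqrt_mult)
  qed
  have D: "distr \<Theta> ?P ?F = \<pi>"
    unfolding \<Theta>_def g_def \<pi> by (rule pull(2)[OF h])
  have closed: "closed {z. norm (snd z - T (fst z)) \<le> 8 * sqrt (lambda_max A) * \<delta>}"
    unfolding T_def by (intro closed_Collect_le continuous_intros continuous_on_matrix_vector_mult)
  have setsPb: "sets ?P = sets borel"
    unfolding setsP borel_prod ..
  then have sets\<pi>: "sets \<pi> = sets borel"
    by (simp add: \<pi>)
  have "AE z in distr \<Theta> ?P ?F. norm (snd z - T (fst z)) \<le> 8 * sqrt (lambda_max A) * \<delta>"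
  proof (subst AE_distr_iff)
    show "{z \<in> space ?P. norm (snd z - T (fst z)) \<le> 8 * sqrt (lambda_max A) * \<delta>} \<in> sets ?P"
      using closed setsPb sets_eq_imp_space_eq[OF setsPb] by simp
  qed (use AE1 Fm in \<open>auto simp: measurable_cong_sets[OF sets_\<Theta> refl]\<close>)
  then have "AE z in \<pi>. norm (snd z - T (fst z)) \<le> 8 * sqrt (lambda_max A) * \<delta>"
    unfolding D .
  from msupport_AE_closed[OF sets\<pi> closed this z] show ?thesis
    by (simp add: T_def)
qed

theorem theorem3p11:
  fixes \<mu> \<nu> :: "(real^'d) measure"
    and \<Omega> :: "(real^'d) set"
    and \<rho> :: "real^'d \<Rightarrow> real"
    and lam_lo lam_hi :: real
    and A :: "real^'d^'d" and a :: "real^'d"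
    and rA \<epsilon> :: real
    and \<pi> :: "((real^'d) \<times> (real^'d)) measure"
  assumes mu_prob: "prob_space \<mu>" and mu_sets: "sets \<mu> = sets borel"
    and dom_lip: "lipschitz_domain \<Omega>" and dom_conn: "connected \<Omega>"
    and dom_open: "open \<Omega>" and dom_bdd: "bounded \<Omega>"
    and dom_ball: "\<Omega> \<subseteq> cball 0 1"
    and rho_meas: "\<rho> \<in> borel_measurable lborel"
    and mu_dens: "\<mu> = density lborel (\<lambda>x. ennreal (\<rho> x * indicator \<Omega> x))"
    and lam_pos: "0 < lam_lo" and lam_le: "lam_lo \<le> lam_hi"
    and rho_bounds: "AE x in lborel. x \<in> \<Omega> \<longrightarrow> lam_lo \<le> \<rho> x \<and> \<rho> x \<le> lam_hi"
    and nu_prob: "prob_space \<nu>" and nu_sets: "sets \<nu> = sets borel"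
    and A_pd: "pos_def_matrix A"
    and monge: "monge_map \<mu> \<nu> (\<lambda>x. A *v x + a)"
    and rA_pos: "rA > 0"
    and eps_pos: "0 < \<epsilon>"
    and eps_le: "\<epsilon> \<le> lam_lo / sqrt (det A)
          * (INF u\<in>msupport (distr \<mu> borel (\<lambda>x. matrix_sqrt A *v x)).
               INF r\<in>{0<..rA}. measure lborel ((\<lambda>x. matrix_sqrt A *v x) ` \<Omega> \<inter> cball u r)
                               / (omega CARD('d) * r ^ CARD('d)))
          * omega CARD('d) * rA ^ (CARD('d) + 2)"
    and pi_min: "qrot_minimizer \<mu> \<nu> \<epsilon> \<pi>"
  shows "let d = CARD('d);
             \<kappa> = (INF u\<in>msupport (distr \<mu> borel (\<lambda>x. matrix_sqrt A *v x)).
                   INF r\<in>{0<..rA}. measure lborel ((\<lambda>x. matrix_sqrt A *v x) ` \<Omega> \<inter> cball u r)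
                                   / (omega d * r ^ d));
             lamA = lam_lo / sqrt (det A)
         in (\<forall>(x, y)\<in>msupport \<pi>. norm (y - (A *v x + a))
                \<le> 8 * sqrt (lambda_max A) * (\<epsilon> / (lamA * \<kappa> * omega d)) powr (1 / (real d + 2)))
            \<and> 8 * sqrt (lambda_max A) * (\<epsilon> / (lamA * \<kappa> * omega d)) powr (1 / (real d + 2))
              = 8 * sqrt (lambda_max A)
                * (sqrt (det A) * Gamma (real d / 2 + 1) / (lam_lo * \<kappa> * pi powr (real d / 2))) powr (1 / (real d + 2))
                * \<epsilon> powr (1 / (real d + 2))"
proof -
  define S where "S = matrix_sqrt A"
  define d where "d = CARD('d)"
  define \<kappa> where "\<kappa> = (INF u\<in>msupport (distr \<mu> borel (\<lambda>x. S *v x)).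
    INF r\<in>{0<..rA}. measure lborel ((\<lambda>x. S *v x) ` \<Omega> \<inter> cball u r) / (omega d * r ^ d))"
  define lamA where "lamA = lam_lo / sqrt (det A)"
  \<comment> \<open>\<open>m * \<delta> ^ d\<close> will bound from below the \<mu>-mass of the
    preimage under \<open>S\<close> of a \<delta>-ball centred in the support of the image measure.
    The next definition solves \<open>m * \<delta> ^ (d + 2) = \<epsilon>\<close>, so this mass is
    at least \<epsilon> / \<delta>^2.\<close>
  define m where "m = lamA * \<kappa> * omega d"
  define \<delta> where "\<delta> = (\<epsilon> / m) powr (1 / (real d + 2))"
  have omega: "0 < omega d"
    by (simp add: omega_def)
  have psd: "pos_semidef_matrix A"
    unfolding pos_semidef_matrix_def
  proof (intro conjI allI)
    show "0 \<le> x \<bullet> (A *v x)" for x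
      using A_pd by (cases "x = 0") (auto simp: pos_def_matrix_def less_imp_le)
  qed (use A_pd in \<open>simp add: pos_def_matrix_def\<close>)
  have S: "sym_matrix S" "S ** S = A"
    using matrix_sqrt_props[OF psd] by (auto simp: S_def pos_semidef_matrix_def)
  have "x = 0" if "A *v x = 0" for x
    using A_pd that by (auto simp: pos_def_matrix_def)
  then have "inj ((*v) A)"
    by (intro linear_injective_0[THEN iffD2]) auto
  then have invA: "invertible A"
    by (metis invertible_left_inverse matrix_left_invertible_injective)
  have detS: "det S * det S = det A"
    by (simp flip: det_mul add: S(2))
  then have invS: "invertible S" and abs: "\<bar>det S\<bar> = sqrt (det A)"
    using invA by (auto simp: invertible_det_nz simp flip: real_sqrt_abs2)
  have "0 \<le> det A"
    unfolding detS[symmetric] by simp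
  then have detpos: "0 < sqrt (det A)"
    using invA by (simp add: invertible_det_nz)
  have lamA: "0 < lamA"
    using lam_pos detpos by (simp add: lamA_def)
  have eps_m: "\<epsilon> \<le> m * rA ^ (d + 2)"
    using eps_le by (simp add: m_def lamA_def \<kappa>_def S_def d_def)
  \<comment> \<open>Positivity of \<kappa> is not a hypothesis: it follows from the existence of a
    positive \<epsilon> below the threshold.\<close>
  then have "0 < m * rA ^ (d + 2)"
    using eps_pos by linarith
  then have m: "0 < m"
    by (rule zero_less_mult_pos2) (simp add: rA_pos)
  then have kappa: "0 < \<kappa>"
    using lamA omega by (simp add: m_def zero_less_mult_iff)
  have delta: "0 < \<delta>"
    using eps_pos m by (simp add: \<delta>_def)
  have "\<delta> ^ (d + 2) = \<delta> powr real (d + 2)"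
    using delta by (rule powr_realpow[symmetric])
  also have "\<dots> = (\<epsilon> / m) powr (1 / (real d + 2) * real (d + 2))"
    by (simp add: \<delta>_def powr_powr)
  also have "1 / (real d + 2) * real (d + 2) = 1"
    by simp
  finally have delta_pow: "m * \<delta> ^ (d + 2) = \<epsilon>"
    using eps_pos m by simp
  \<comment> \<open>The threshold on \<epsilon> makes \<delta> an admissible radius in the infimum
    defining \<kappa>.\<close>
  then have "\<delta> ^ (d + 2) \<le> rA ^ (d + 2)"
    using eps_m m by (metis mult_le_cancel_left_pos)
  then have delta_le: "\<delta> \<le> rA"
    using power_le_imp_le_base[of \<delta> "Suc d" rA] rA_pos by simp
  have bdd: "AE x in \<mu>. x \<in> cball 0 1"
  proof -
    have "AE x in \<mu>. x \<in> \<Omega>"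
    proof -
      have [measurable]: "\<rho> \<in> borel_measurable borel" "\<Omega> \<in> sets borel"
        using rho_meas dom_open by simp_all
      show ?thesis
        unfolding mu_dens by (subst AE_density, measurable) (auto simp: indicator_def)
    qed
    then show ?thesis
      by eventually_elim (use dom_ball in auto)
  qed
  have Sm: "(*v) S \<in> \<mu> \<rightarrow>\<^sub>M borel"
    unfolding measurable_cong_sets[OF mu_sets refl]
    by (intro borel_measurable_continuous_onI continuous_intros)
  have "AE u in distr \<mu> borel ((*v) S). u \<in> msupport (distr \<mu> borel ((*v) S))"
    by (rule AE_msupport) simp
  then have supp: "AE x in \<mu>. S *v x \<in> msupport (distr \<mu> borel ((*v) S))"
    using AE_distrD[OF Sm] by blast
  have mass: "AE x in \<mu>. \<epsilon> \<le> \<delta>\<^sup>2 * measure \<mu> {y. norm (S *v x - S *v y) \<le> \<delta>}"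
    using supp
  proof eventually_elim
    case (elim x)
    let ?q = "\<lambda>u r. measure lborel ((\<lambda>x. S *v x) ` \<Omega> \<inter> cball u r) / (omega d * r ^ d)"
    have q0: "0 \<le> ?q u r" if "r \<in> {0<..rA}" for u r
      using omega that by simp
    have bb: "bdd_below (?q u ` {0<..rA})" for u
      by (rule bdd_belowI2[of _ 0]) (rule q0)
    \<comment> \<open>A real infimum is a lower bound only for a set bounded below; nonnegativity of
      the quotients settles this for the inner and the outer infimum.\<close>
    have "\<kappa> \<le> (INF r\<in>{0<..rA}. ?q (S *v x) r)"
      unfolding \<kappa>_def
    proof (rule cINF_lower[OF bdd_belowI2[of _ 0] elim])
      show "0 \<le> (INF r\<in>{0<..rA}. ?q u r)" for u
        using rA_pos by (intro cINF_greatest q0) auto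
    qed
    also have "\<dots> \<le> ?q (S *v x) \<delta>"
      using delta delta_le by (intro cINF_lower bb) auto
    finally have "\<kappa> * (omega d * \<delta> ^ d) \<le> measure lborel ((\<lambda>x. S *v x) ` \<Omega> \<inter> cball (S *v x) \<delta>)"
      using omega delta by (simp add: pos_le_divide_eq)
    also have "\<dots> = sqrt (det A) * measure lborel (\<Omega> \<inter> {y. norm (S *v x - S *v y) \<le> \<delta>})"
      unfolding image_cball_measure[OF invS dom_open dom_bdd] abs ..
    \<comment> \<open>The factor \<open>sqrt (det A)\<close> from the change of volume cancels the
      one in \<open>lamA\<close>, leaving the lower density bound \<open>lam_lo\<close>.\<close>
    finally have "lamA * (\<kappa> * (omega d * \<delta> ^ d)) \<le>
        lamA * (sqrt (det A) * measure lborel (\<Omega> \<inter> {y. norm (S *v x - S *v y) \<le> \<delta>}))"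
      using lamA by (intro mult_left_mono) auto
    also have "\<dots> = lam_lo * measure lborel (\<Omega> \<inter> {y. norm (S *v x - S *v y) \<le> \<delta>})"
      using detpos by (simp add: lamA_def)
    also have "\<dots> \<le> measure \<mu> {y. norm (S *v x - S *v y) \<le> \<delta>}"
    proof (rule density_indicator_lower_bound[OF mu_prob rho_meas _ _ mu_dens _ _ dom_bdd])
      show "AE x in lborel. x \<in> \<Omega> \<longrightarrow> lam_lo \<le> \<rho> x"
        using rho_bounds by eventually_elim auto
      show "{y. norm (S *v x - S *v y) \<le> \<delta>} \<in> sets borel"
        by (intro borel_closed closed_Collect_le continuous_intros)
    qed (use dom_open lam_pos in auto)
    finally have "\<delta>\<^sup>2 * (m * \<delta> ^ d) \<le> \<delta>\<^sup>2 * measure \<mu> {y. norm (S *v x - S *v y) \<le> \<delta>}"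
      by (intro mult_left_mono) (simp_all add: m_def mult.assoc)
    then show ?case
      using delta_pow by (simp add: power_add mult_ac power2_eq_square)
  qed
  have law: "distr \<mu> borel (\<lambda>x. A *v x + a) = \<nu>"
    using monge by (simp add: monge_map_def)
  have bound: "norm (snd z - (A *v fst z + a)) \<le> 8 * sqrt (lambda_max A) * \<delta>" if "z \<in> msupport \<pi>" for z
    by (rule qrot_support_near_affine[OF mu_prob mu_sets nu_sets bdd S invA law pi_min eps_pos delta mass that])
  define X where "X = sqrt (det A) * Gamma (real d / 2 + 1) / (lam_lo * \<kappa> * pi powr (real d / 2))"
  have "\<epsilon> / m = X * \<epsilon>"
    by (simp add: X_def m_def lamA_def omega_def)
  moreover have "0 \<le> X"
    unfolding X_def
    using detpos lam_pos kappa by (intro divide_nonneg_nonneg mult_nonneg_nonneg) (auto intro: less_imp_le)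
  ultimately have "\<delta> = X powr (1 / (real d + 2)) * \<epsilon> powr (1 / (real d + 2))"
    using eps_pos powr_mult[of X \<epsilon>] by (simp add: \<delta>_def)
  then show ?thesis
    using bound unfolding Let_def X_def \<delta>_def m_def lamA_def \<kappa>_def d_def S_def by auto
qed

end
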